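(* Let $\mathcal H$ be a complex Hilbert space of finite dimension $n$ with $3\le n<+\infty$, and let $\varphi:\mathcal P(\mathcal H)\to\mathcal P(\mathcal H)$ be a surjective map. Then the following are equivalent. (1) $\varphi$ shrinks the joint spectrum of any two projections, i.e. $\sigma([\varphi(P),\varphi(Q)])\subseteq\sigma([P,Q])$ for all $P,Q\in\mathcal P(\mathcal H)$. (2) $\varphi$ preserves the joint spectrum of any two projections, i.e. $\sigma([\varphi(P),\varphi(Q)])=\sigma([P,Q])$ for all $P,Q\in\mathcal P(\mathcal H)$. (3) There exist an orthonormal basis $\alpha_1,\dots,\alpha_n$ of $\mathcal H$, a basis $\beta_1,\dots,\beta_n$ of $\mathcal H$ and a ring automorphism $f$ of $\mathbb C$ such that $$\varphi(P)(\mathcal H)=\{\hat f(P\xi):\xi\in\mathcal H\}\quad\text{for all }P\in\mathcal P(\mathcal H),$$ where $\hat f:\mathcal H\to\mathcal H$ is given by $\hat f(z_1\alpha_1+\dots+z_n\alpha_n)=f(z_1)\beta_1+\dots+f(z_n)\beta_n$ for $z_1,\dots,z_n\in\mathbb C$.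
   Context: $\mathcal P(\mathcal H)$ denotes the set of all (orthogonal) projections on $\mathcal H$, i.e. operators $P$ with $P=P^*=P^2$; $P(\mathcal H)$ denotes the range of $P$. For operators $A_1,\dots,A_l$ on $\mathcal H$, the joint spectrum is $\sigma([A_1,\dots,A_l])=\{(c_1,\dots,c_l)\in\mathbb C^l: c_1A_1+\dots+c_lA_l\text{ is not invertible in }\mathcal B(\mathcal H)\}$. A ring automorphism of $\mathbb C$ is a bijection $f:\mathbb C\to\mathbb C$ with $f(z+w)=f(z)+f(w)$ and $f(zw)=f(z)f(w)$ (no continuity is assumed). *)

theory Defs
  imports "HOL-Analysis.Analysis"
begin

text \<open>
  A complex Hilbert space, presented on top of the underlying real one: norm and topology are those
  of \<^class>\<open>real_inner\<close>, completeness is that of \<^class>\<open>complete_space\<close>, and \<open>Re_cinner\<close> gives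
  \<open>(norm x)\<^sup>2 = cinner x x\<close> and positive definiteness.  The complex inner product is linear in its
  first argument.
\<close>

class chilbert_space = real_inner + complete_space +
  fixes scaleC :: "complex \<Rightarrow> 'a \<Rightarrow> 'a"  (infixr "*\<^sub>C" 75)
    and cinner :: "'a \<Rightarrow> 'a \<Rightarrow> complex"
  assumes scaleC_add_right: "c *\<^sub>C (x + y) = c *\<^sub>C x + c *\<^sub>C y"
    and scaleC_add_left: "(c + d) *\<^sub>C x = c *\<^sub>C x + d *\<^sub>C x"
    and scaleC_scaleC: "c *\<^sub>C d *\<^sub>C x = (c * d) *\<^sub>C x"
    and scaleC_of_real: "complex_of_real r *\<^sub>C x = r *\<^sub>R x"
    and cinner_add_left: "cinner (x + y) z = cinner x z + cinner y z"
    and cinner_scaleC_left: "cinner (c *\<^sub>C x) y = c * cinner x y"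
    and cinner_commute: "cinner x y = cnj (cinner y x)"
    and Re_cinner: "Re (cinner x y) = x \<bullet> y"

text \<open>
  \<open>complex_vector.dim UNIV\<close> is \<open>0\<close> on a space without a finite basis, so a nonzero value means that
  the space is finite-dimensional.
\<close>

global_interpretation complex_vector: vector_space
  "scaleC :: complex \<Rightarrow> 'a \<Rightarrow> 'a::chilbert_space"
proof
  show "1 *\<^sub>C x = x" for x :: 'a
    using scaleC_of_real[of 1 x] by simp
qed (simp_all add: scaleC_add_right scaleC_add_left scaleC_scaleC)

definition bounded_operator :: "('a::chilbert_space \<Rightarrow> 'a) \<Rightarrow> bool" where
  "bounded_operator A \<longleftrightarrow> bounded_linear A \<and> (\<forall>c x. A (c *\<^sub>C x) = c *\<^sub>C A x)"

definition invertible_operator :: "('a::chilbert_space \<Rightarrow> 'a) \<Rightarrow> bool" where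
  "invertible_operator A \<longleftrightarrow>
     bounded_operator A \<and> (\<exists>B. bounded_operator B \<and> A \<circ> B = id \<and> B \<circ> A = id)"

text \<open>\<open>is_adjoint A B\<close> says \<open>B = A\<^sup>*\<close>; adjoints are unique because \<^const>\<open>cinner\<close> is definite.\<close>

definition is_adjoint :: "('a::chilbert_space \<Rightarrow> 'a) \<Rightarrow> ('a \<Rightarrow> 'a) \<Rightarrow> bool" where
  "is_adjoint A B \<longleftrightarrow> (\<forall>x y. cinner (A x) y = cinner x (B y))"

definition projections :: "('a::chilbert_space \<Rightarrow> 'a) set" where
  "projections = {P. bounded_operator P \<and> is_adjoint P P \<and> P \<circ> P = P}"

definition joint_spectrum :: "('a::chilbert_space \<Rightarrow> 'a) list \<Rightarrow> complex list set" where
  "joint_spectrum As =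
     {cs. length cs = length As \<and>
          \<not> invertible_operator (\<lambda>x. \<Sum>i<length As. (cs ! i) *\<^sub>C (As ! i) x)}"

definition complex_ring_automorphism :: "(complex \<Rightarrow> complex) \<Rightarrow> bool" where
  "complex_ring_automorphism f \<longleftrightarrow>
     bij f \<and> (\<forall>z w. f (z + w) = f z + f w) \<and> (\<forall>z w. f (z * w) = f z * f w)"

definition is_basis :: "nat \<Rightarrow> (nat \<Rightarrow> 'a::chilbert_space) \<Rightarrow> bool" where
  "is_basis n \<beta> \<longleftrightarrow>
     inj_on \<beta> {1..n} \<and> complex_vector.independent (\<beta> ` {1..n}) \<and>
     complex_vector.span (\<beta> ` {1..n}) = UNIV"

definition is_orthonormal_basis :: "nat \<Rightarrow> (nat \<Rightarrow> 'a::chilbert_space) \<Rightarrow> bool" where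
  "is_orthonormal_basis n \<alpha> \<longleftrightarrow>
     is_basis n \<alpha> \<and> (\<forall>i\<in>{1..n}. \<forall>j\<in>{1..n}. cinner (\<alpha> i) (\<alpha> j) = (if i = j then 1 else 0))"

text \<open>
  The defining equation of the coordinatewise map induced by \<open>f\<close>. When \<open>\<alpha>\<close> is a basis,
  exactly one function \<open>h\<close> satisfies it.
\<close>

definition is_hat ::
  "nat \<Rightarrow> (nat \<Rightarrow> 'a::chilbert_space) \<Rightarrow> (nat \<Rightarrow> 'a) \<Rightarrow> (complex \<Rightarrow> complex) \<Rightarrow> ('a \<Rightarrow> 'a) \<Rightarrow> bool" where
  "is_hat n \<alpha> \<beta> f h \<longleftrightarrow>
     (\<forall>z :: nat \<Rightarrow> complex. h (\<Sum>i=1..n. z i *\<^sub>C \<alpha> i) = (\<Sum>i=1..n. f (z i) *\<^sub>C \<beta> i))"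

end

theory Submission imports Defs begin

text \<open>
  A projection is determined by its range, so a map of projections is a map \<open>\<Phi>\<close> of subspaces. The
  proof translates the joint spectrum into the geometry of subspaces and then appeals to projective
  geometry.

  For projections \<open>P\<close> and \<open>Q\<close> and nonzero \<open>a\<close> and \<open>b\<close>, the operator \<open>a P + b Q\<close> is invertible exactly
  if the ranges span the space and, in case \<open>a + b = 0\<close>, meet in \<open>0\<close>
  (\<open>invertible_combination_iff\<close>). Semilinear bijections respect spanning and trivial intersection, so
  an induced map preserves the joint spectrum. Conversely, shrinking the joint spectrum means that
  pairs of subspaces that span, and pairs that are complementary, are mapped to pairs of the same
  kind (\<open>complement_preserving_of_shrinking\<close>).

  The main part shows that a surjective map \<open>\<Phi>\<close> with these two properties comes from a semilinear
  bijection (\<open>semilinear_representation\<close>), over any field. Subspaces of equal dimension have a common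
  complement, so \<open>dim (\<Phi> M)\<close> is a function of \<open>dim M\<close>; it is monotone and surjective, hence the
  identity. In particular \<open>\<Phi>\<close> maps points to points and hyperplanes to hyperplanes. A point outside
  a hyperplane is a complement of it, so \<open>\<Phi>\<close> reflects incidence of points and hyperplanes, and
  surjectivity together with an exchange argument upgrades this to a collineation: \<open>\<Phi>\<close> preserves and
  reflects membership of a point in the span of other points (\<open>collineation_T\<close>).

  The fundamental theorem of projective geometry then gives a field automorphism and a basis
  that describe \<open>\<Phi>\<close> on points. In its proof the image basis is normalized by the image of
  the unit point; in the chart of points with a distinguished coordinate \<open>1\<close> the collineation acts
  on each coordinate by the same function \<open>f\<close>, and additivity and multiplicativity of \<open>f\<close> are read off
  from collinear points in a plane. Finally the description is carried over from points to
  hyperplanes and to all subspaces by comparing complements (\<open>eq_image_of_semilinear_lift\<close>).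
\<close>

section \<open>Complementary subspaces\<close>

locale fin_dim_space = finite_dimensional_vector_space scale Basis
  for scale :: "'k::field \<Rightarrow> 'v::ab_group_add \<Rightarrow> 'v"  (infixr "\<odot>" 75) and Basis
begin

definition complementary :: "'v set \<Rightarrow> 'v set \<Rightarrow> bool" where
  "complementary M N \<longleftrightarrow>
     subspace M \<and> subspace N \<and> span (M \<union> N) = UNIV \<and> M \<inter> N = {0}"

lemma complementaryI:
  assumes "subspace M" "subspace N"
    and "\<And>x. \<exists>m\<in>M. \<exists>k\<in>N. x = m + k" and "\<And>x. x \<in> M \<Longrightarrow> x \<in> N \<Longrightarrow> x = 0"
  shows "complementary M N"
proof -
  have "x \<in> span (M \<union> N)" for x
  proof -
    obtain m k where "m \<in> M" "k \<in> N" "x = m + k"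
      using assms(3) by blast
    then show ?thesis
      by (auto intro: span_add span_base)
  qed
  moreover have "M \<inter> N = {0}"
    using assms(1,2,4) subspace_0 by blast
  ultimately show ?thesis
    using assms(1,2) by (auto simp: complementary_def)
qed

lemma complementaryD:
  assumes "complementary M N"
  shows "subspace M" "subspace N" "span (M \<union> N) = UNIV" "M \<inter> N = {0}"
  using assms by (simp_all add: complementary_def)

lemma span_Un_subspaces:
  assumes "subspace M" "subspace N"
  shows "span (M \<union> N) = {x + y |x y. x \<in> M \<and> y \<in> N}"
  using span_Un[of M N] assms by (simp add: span_eq_iff[THEN iffD2])

lemma complementary_decompose:
  assumes "complementary M N"
  obtains m k where "m \<in> M" "k \<in> N" "x = m + k"
  using assms span_Un_subspaces[of M N] unfolding complementary_def by blast

text \<open>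
  Complements cannot be enlarged: if \<open>y \<in> M'\<close> is split along \<open>M\<close> and \<open>N\<close>, then its \<open>N\<close>-part lies in
  \<open>M' \<inter> N'\<close>. This turns a one-sided inclusion between images of subspaces into an equality whenever
  the same inclusion is known for a complement.
\<close>

lemma complementary_eqI:
  assumes "complementary M N" and "complementary M' N'" and "M \<subseteq> M'" "N \<subseteq> N'"
  shows "M = M'"
proof
  show "M' \<subseteq> M"
  proof
    fix y assume y: "y \<in> M'"
    obtain m k where mk: "m \<in> M" "k \<in> N" "y = m + k"
      using assms(1) by (rule complementary_decompose)
    have "k = y - m"
      using mk by simp
    then have "k \<in> M'"
      using y mk assms by (metis complementary_def subspace_diff subsetD)
    then have "k = 0"
      using mk assms unfolding complementary_def by blast
    then show "y \<in> M"
      using mk by simp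
  qed
qed fact

lemma nonmember_of_two_subspaces:
  assumes "subspace M" "subspace N" "M \<noteq> UNIV" "N \<noteq> UNIV"
  obtains x where "x \<notin> M" "x \<notin> N"
proof (cases "M \<subseteq> N \<or> N \<subseteq> M")
  case True
  then show ?thesis
    using assms(3,4) that by blast
next
  case False
  then obtain a b where ab: "a \<in> M" "a \<notin> N" "b \<in> N" "b \<notin> M"
    by blast
  then have "a + b \<notin> M" "a + b \<notin> N"
    using assms by (metis add_diff_cancel_left' subspace_diff, metis add_diff_cancel_right' subspace_diff)
  then show ?thesis
    by (rule that)
qed

text \<open>
  A vector \<open>x\<close> can be moved from one half of a complementary pair to the other. This is the
  step of the induction that produces common complements.
\<close>

lemma complementary_insert:
  assumes c: "complementary (span (insert x M)) N" and M: "subspace M" and x: "x \<notin> M"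
  shows "complementary M (span (insert x N))"
proof (rule complementaryI)
  have N: "subspace N"
    using c by (simp add: complementary_def)
  have sM: "span M = M" and sN: "span N = N"
    using M N by simp_all
  show "\<exists>m\<in>M. \<exists>k\<in>span (insert x N). y = m + k" for y
  proof -
    obtain m k where mk: "m \<in> span (insert x M)" "k \<in> N" "y = m + k"
      using c by (rule complementary_decompose)
    then obtain a where a: "m - a \<odot> x \<in> M"
      using sM span_breakdown_eq[of m x M] by auto
    have "k + a \<odot> x \<in> span (insert x N)"
      using mk(2) by (auto intro: span_add span_scale span_base)
    moreover have "y = (m - a \<odot> x) + (k + a \<odot> x)"
      using mk by simp
    ultimately show ?thesis
      using a by blast
  qed
  show "y = 0" if y: "y \<in> M" "y \<in> span (insert x N)" for y
  proof -
    obtain a where a: "y - a \<odot> x \<in> N"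
      using y(2) sN span_breakdown_eq[of y x N] by auto
    moreover have "y - a \<odot> x \<in> span (insert x M)"
      using y(1) by (auto intro: span_diff span_scale span_base)
    ultimately have eq: "y = a \<odot> x"
      using c unfolding complementary_def by (metis IntI eq_iff_diff_eq_0 singletonD)
    have "a = 0"
    proof (rule ccontr)
      assume "a \<noteq> 0"
      then have "x = inverse a \<odot> y"
        using eq by simp
      then show False
        using M y(1) x by (simp add: subspace_scale)
    qed
    then show ?thesis
      using eq by simp
  qed
qed (use M in auto)

lemma dim_span_Un_subspaces:
  assumes "subspace M" "subspace N"
  shows "dim (span (M \<union> N)) + dim (M \<inter> N) = dim M + dim N"
  using dim_sums_Int[OF assms] span_Un_subspaces[OF assms] by simp

lemma complementary_dim:
  assumes "complementary M N"
  shows "dim M + dim N = dimension"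
  using assms dim_span_Un_subspaces[of M N] by (simp add: complementary_def dimension_def)

lemma dimension_le_dim_sum:
  assumes "subspace M" "subspace N" "span (M \<union> N) = UNIV"
  shows "dimension \<le> dim M + dim N"
  using assms dim_span_Un_subspaces[of M N] by (simp add: dimension_def)

lemma dim_UNIV_imp_UNIV:
  assumes "subspace M" "dim M = dimension"
  shows "M = UNIV"
  using assms dim_eq_full[of M] span_eq_iff[of M] by simp

text \<open>
  Downward induction on the dimension: two proper subspaces do not cover the space, so some \<open>x\<close>
  avoids both; enlarge both by \<open>x\<close>, take a common complement, and move \<open>x\<close> over to it. The case
  \<open>M = M'\<close> is the existence of complements.
\<close>

lemma common_complement:
  assumes "subspace M" "subspace M'" "dim M = dim M'"
  shows "\<exists>N. complementary M N \<and> complementary M' N"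
  using assms
proof (induction "dimension - dim M" arbitrary: M M')
  case 0
  then have "dim M = dimension"
    using dim_subset_UNIV[of M] by simp
  then have "M = UNIV" "M' = UNIV"
    using "0.prems" dim_UNIV_imp_UNIV by auto
  then have "complementary M {0} \<and> complementary M' {0}"
    by (auto simp: complementary_def insert_absorb)
  then show ?case
    by blast
next
  case (Suc d)
  then have "dim M \<noteq> dimension"
    by simp
  then have "M \<noteq> UNIV" "M' \<noteq> UNIV"
    using Suc.prems by (auto simp: dimension_def)
  then obtain x where x: "x \<notin> M" "x \<notin> M'"
    using nonmember_of_two_subspaces Suc.prems by metis
  have dims: "dim (span (insert x M)) = Suc (dim M)" "dim (span (insert x M')) = Suc (dim M')"
    using x Suc.prems by (simp_all add: dim_insert span_eq_iff[THEN iffD2])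
  have "\<exists>N. complementary (span (insert x M)) N \<and> complementary (span (insert x M')) N"
    by (rule Suc.hyps(1)) (use Suc.hyps(2) Suc.prems dims in auto)
  then show ?case
    using complementary_insert x Suc.prems by blast
qed

text \<open>
  Add to \<open>M\<close> a complement of \<open>M + N\<close>.
\<close>

lemma complement_containing:
  assumes M: "subspace M" and N: "subspace N" and MN: "M \<inter> N = {0}"
  obtains K where "M \<subseteq> K" "complementary K N"
proof -
  obtain C where C: "complementary (span (M \<union> N)) C"
    using common_complement[of "span (M \<union> N)" "span (M \<union> N)"] by auto
  then have sC: "subspace C"
    by (simp add: complementary_def)
  have MC: "span (M \<union> C) = {x + y |x y. x \<in> M \<and> y \<in> C}"
    using M sC by (rule span_Un_subspaces)
  have MN': "span (M \<union> N) = {x + y |x y. x \<in> M \<and> y \<in> N}"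
    using M N by (rule span_Un_subspaces)
  have "complementary (span (M \<union> C)) N"
  proof (rule complementaryI)
    show "\<exists>m\<in>span (M \<union> C). \<exists>k\<in>N. x = m + k" for x
    proof -
      obtain u c where "u \<in> span (M \<union> N)" "c \<in> C" "x = u + c"
        using C by (rule complementary_decompose)
      then obtain m k where "m \<in> M" "k \<in> N" "c \<in> C" "x = (m + c) + k"
        using MN' by (auto simp: algebra_simps)
      then show ?thesis
        using MC by blast
    qed
    show "x = 0" if x: "x \<in> span (M \<union> C)" "x \<in> N" for x
    proof -
      obtain m c where mc: "m \<in> M" "c \<in> C" "x = m + c"
        using x(1) unfolding MC by blast
      have "x - m \<in> span (M \<union> N)"
        using mc(1) x(2) by (simp add: span_diff span_base)
      then have "c \<in> span (M \<union> N)"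
        using mc(3) by simp
      then have "c = 0"
        using mc C by (auto simp: complementary_def)
      then show ?thesis
        using mc x MN by auto
    qed
  qed (use N in auto)
  moreover have "M \<subseteq> span (M \<union> C)"
    using span_superset by blast
  ultimately show ?thesis
    using that by blast
qed

lemma hyperplane_separating:
  assumes M: "subspace M" and x: "x \<notin> M"
  obtains K where "M \<subseteq> K" "complementary K (span {x})" "x \<notin> K"
proof -
  have "M \<inter> span {x} = {0}"
  proof -
    have "a \<odot> x = 0" if "a \<odot> x \<in> M" for a
    proof (rule ccontr)
      assume "a \<odot> x \<noteq> 0"
      then have "x = inverse a \<odot> (a \<odot> x)"
        by simp
      then show False
        using that x M subspace_scale by metis
    qed
    then show ?thesis
      using M subspace_0[OF M] by (auto simp: span_singleton)
  qed
  then obtain K where K: "M \<subseteq> K" "complementary K (span {x})"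
    using complement_containing M by (metis subspace_span)
  have "x \<noteq> 0"
    using x subspace_0[OF M] by auto
  then have "x \<notin> K"
    using K(2) span_base[of x "{x}"] by (auto simp: complementary_def)
  then show ?thesis
    using K that by blast
qed

lemma hyperplane_complementary_line:
  assumes K: "subspace K" "dim K + 1 = dimension" and x: "x \<notin> K"
  shows "complementary K (span {x})"
proof -
  obtain K' where K': "K \<subseteq> K'" "complementary K' (span {x})"
    using hyperplane_separating[OF K(1) x] by blast
  have "x \<noteq> 0"
    using x subspace_0[OF K(1)] by auto
  then have "dim K' + 1 = dimension"
    using complementary_dim[OF K'(2)] by simp
  then have "K = K'"
    using K K' subspace_dim_equal[of K K'] by (simp add: complementary_def)
  then show ?thesis
    using K' by simp
qed

lemma subspace_dim_le_1_eq_span: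
  assumes "subspace M" "dim M \<le> 1"
  obtains x where "M = span {x}"
proof -
  obtain B where B: "B \<subseteq> M" "independent B" "M \<subseteq> span B" "card B = dim M"
    using basis_exists by blast
  then have fin: "finite B" and M: "M = span B"
    using finiteI_independent span_minimal[of B M] assms(1) by auto
  show ?thesis
  proof (cases "B = {}")
    case True
    then have "M = span {0}"
      using M by simp
    then show ?thesis
      by (rule that)
  next
    case False
    then have "card B = 1"
      using B(4) assms(2) fin False by (metis One_nat_def card_0_eq le_Suc_eq le_zero_eq)
    then obtain x where "B = {x}"
      using card_1_singletonE by blast
    then show ?thesis
      using M that by blast
  qed
qed

text \<open>
  A family and not a set, because injectivity of the indexing is part of what has to be shown.
\<close>

lemma spanning_family_of_dimension_size:
  assumes span: "span (e ` I) = UNIV" and I: "finite I" "card I \<le> dimension"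
  shows "inj_on e I" "independent (e ` I)"
proof -
  have "dimension \<le> card (e ` I)"
    using span_card_ge_dim[of UNIV "e ` I"] dim_le_card[of UNIV "e ` I"] span I by (simp add: dimension_def)
  then have eq: "card (e ` I) = card I" "card (e ` I) = dimension"
    using card_image_le[OF I(1), of e] I(2) by simp_all
  show "inj_on e I"
    using eq(1) I(1) by (rule eq_card_imp_inj_on[rotated])
  show "independent (e ` I)"
    using card_le_dim_spanning[of "e ` I" UNIV] span I(1) eq(2) by (simp add: dimension_def)
qed

end

text \<open>
  Such a map is injective, hence strictly increasing and \<open>j \<le> d j\<close>; a strict inequality is excluded
  because the values \<open>d j\<close> and the arguments \<open>j\<close> have the same sum.
\<close>

lemma mono_surj_atMost_is_id:
  fixes d :: "nat \<Rightarrow> nat"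
  assumes surj: "d ` {..n} = {..n}" and mono: "\<And>i j. i \<le> j \<Longrightarrow> j \<le> n \<Longrightarrow> d i \<le> d j"
    and i: "i \<le> n"
  shows "d i = i"
proof -
  have inj: "inj_on d {..n}"
    using surj by (simp add: eq_card_imp_inj_on)
  have le: "j \<le> n \<Longrightarrow> j \<le> d j" for j
  proof (induction j)
    case (Suc j)
    have "d j \<noteq> d (Suc j)"
      using inj Suc.prems by (auto dest: inj_onD)
    then show ?case
      using Suc mono[of j "Suc j"] by fastforce
  qed simp
  have "(\<Sum>j\<le>n. d j) = (\<Sum>j\<le>n. j)"
    using sum.reindex[OF inj, of "\<lambda>j. j"] surj by simp
  then have "\<not> d i > i"
    using sum_strict_mono_ex1[of "{..n}" "\<lambda>j. j" d] le i by force
  then show ?thesis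
    using le[of i] i by simp
qed

section \<open>Coordinates\<close>

context fin_dim_space
begin

definition indexed_basis :: "'i set \<Rightarrow> ('i \<Rightarrow> 'v) \<Rightarrow> bool" where
  "indexed_basis I e \<longleftrightarrow> finite I \<and> inj_on e I \<and> independent (e ` I) \<and> span (e ` I) = UNIV"

definition lincomb :: "'i set \<Rightarrow> ('i \<Rightarrow> 'v) \<Rightarrow> ('i \<Rightarrow> 'k) \<Rightarrow> 'v" where
  "lincomb I e c = (\<Sum>i\<in>I. c i \<odot> e i)"

lemma lincomb_add: "lincomb I e (\<lambda>i. c i + d i) = lincomb I e c + lincomb I e d"
  by (simp add: lincomb_def scale_left_distrib sum.distrib)

lemma lincomb_diff: "lincomb I e (\<lambda>i. c i - d i) = lincomb I e c - lincomb I e d"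
  by (simp add: lincomb_def scale_left_diff_distrib sum_subtractf)

lemma lincomb_scale: "lincomb I e (\<lambda>i. a * c i) = a \<odot> lincomb I e c"
  by (simp add: lincomb_def scale_sum_right)

lemma lincomb_cong: "(\<And>i. i \<in> I \<Longrightarrow> c i = d i) \<Longrightarrow> lincomb I e c = lincomb I e d"
  by (simp add: lincomb_def)

lemma lincomb_of_span:
  assumes I: "finite I" "inj_on e I" and J: "J \<subseteq> I" and x: "x \<in> span (e ` J)"
  shows "\<exists>c. x = lincomb I e c \<and> (\<forall>i\<in>I - J. c i = 0)"
proof -
  have "finite (e ` J)"
    using I J finite_subset by blast
  then obtain u where "x = (\<Sum>v\<in>e ` J. u v \<odot> v)"
    using x span_finite by blast
  also have "\<dots> = (\<Sum>i\<in>J. u (e i) \<odot> e i)"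
    using inj_on_subset[OF I(2) J] by (simp add: sum.reindex)
  also have "\<dots> = lincomb I e (\<lambda>i. if i \<in> J then u (e i) else 0)"
    unfolding lincomb_def by (rule sum.mono_neutral_cong_left) (use I J in auto)
  finally show ?thesis
    by (intro exI[of _ "\<lambda>i. if i \<in> J then u (e i) else 0"]) simp
qed

lemma lincomb_exists:
  assumes "indexed_basis I e"
  shows "\<exists>c. x = lincomb I e c"
  using lincomb_of_span[of I e I x] assms by (auto simp: indexed_basis_def)

lemma lincomb_eq_0:
  assumes "indexed_basis I e" "lincomb I e c = 0" "i \<in> I"
  shows "c i = 0"
proof -
  have inj: "inj_on e I"
    using assms by (simp add: indexed_basis_def)
  have "(\<Sum>v\<in>e ` I. c (inv_into I e v) \<odot> v) = lincomb I e c"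
    unfolding lincomb_def by (subst sum.reindex[OF inj]) (simp add: inj)
  then have "c (inv_into I e (e i)) = 0"
    using assms independent_explicit[of "e ` I"] by (auto simp: indexed_basis_def)
  then show ?thesis
    using inj assms(3) by simp
qed

lemma lincomb_inject:
  assumes "indexed_basis I e"
  shows "lincomb I e c = lincomb I e d \<longleftrightarrow> (\<forall>i\<in>I. c i = d i)"
  using lincomb_eq_0[OF assms, of "\<lambda>i. c i - d i"]
  by (auto simp: lincomb_diff intro: lincomb_cong)

lemma lincomb_in_span_iff:
  assumes e: "indexed_basis I e" and J: "J \<subseteq> I"
  shows "lincomb I e c \<in> span (e ` J) \<longleftrightarrow> (\<forall>i\<in>I - J. c i = 0)"
proof
  assume "lincomb I e c \<in> span (e ` J)"
  then obtain d where "lincomb I e c = lincomb I e d" "\<forall>i\<in>I - J. d i = 0"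
    using lincomb_of_span[OF _ _ J, of e] e unfolding indexed_basis_def by blast
  then show "\<forall>i\<in>I - J. c i = 0"
    using lincomb_inject[OF e] by simp
next
  assume "\<forall>i\<in>I - J. c i = 0"
  then have "c i \<odot> e i \<in> span (e ` J)" if "i \<in> I" for i
    using that by (cases "i \<in> J") (auto intro: span_scale span_base span_zero)
  then show "lincomb I e c \<in> span (e ` J)"
    unfolding lincomb_def by (rule span_sum)
qed

lemma lincomb_in_span_insert_iff:
  assumes "indexed_basis I e" "J \<subseteq> I"
  shows "lincomb I e c \<in> span (insert (lincomb I e d) (e ` J)) \<longleftrightarrow> (\<exists>s. \<forall>i\<in>I - J. c i = s * d i)"
proof -
  have "lincomb I e c - s \<odot> lincomb I e d \<in> span (e ` J) \<longleftrightarrow> (\<forall>i\<in>I - J. c i = s * d i)" for s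
    using lincomb_in_span_iff[OF assms, of "\<lambda>i. c i - s * d i"]
    by (simp add: lincomb_diff lincomb_scale)
  then show ?thesis
    by (simp add: span_breakdown_eq)
qed

lemma lincomb_in_span_single_iff:
  assumes "indexed_basis I e"
  shows "lincomb I e c \<in> span {lincomb I e d} \<longleftrightarrow> (\<exists>s. \<forall>i\<in>I. c i = s * d i)"
  using lincomb_in_span_insert_iff[OF assms, of "{}"] by simp

lemma lincomb_in_span_pair_iff:
  assumes "indexed_basis I e"
  shows "lincomb I e c \<in> span {lincomb I e d, lincomb I e d'}
     \<longleftrightarrow> (\<exists>s t. \<forall>i\<in>I. c i = s * d i + t * d' i)"
proof -
  have "lincomb I e c - s \<odot> lincomb I e d \<in> span {lincomb I e d'}
      \<longleftrightarrow> (\<exists>t. \<forall>i\<in>I. c i = s * d i + t * d' i)" for s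
    using lincomb_in_span_single_iff[OF assms, of "\<lambda>i. c i - s * d i" d']
    by (simp add: lincomb_diff lincomb_scale diff_eq_eq add.commute)
  then show ?thesis
    by (simp add: span_breakdown_eq[of _ "lincomb I e d"])
qed

end

section \<open>Semilinear bijections\<close>

definition field_automorphism :: "('k::field \<Rightarrow> 'k) \<Rightarrow> bool" where
  "field_automorphism f \<longleftrightarrow>
     bij f \<and> (\<forall>x y. f (x + y) = f x + f y) \<and> (\<forall>x y. f (x * y) = f x * f y)"

locale semilinear_bijection = fin_dim_space +
  fixes f :: "'a \<Rightarrow> 'a" and h :: "'b \<Rightarrow> 'b"
  assumes f_aut: "field_automorphism f"
    and bij_h: "bij h"
    and h_add: "h (x + y) = h x + h y"
    and h_scale: "h (a \<odot> x) = f a \<odot> h x"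
begin

lemma h_0: "h 0 = 0"
  using h_add[of 0 0] by simp

lemma inj_h: "inj h"
  using bij_h by (rule bij_is_inj)

text \<open>
  Images under \<open>h\<close> are closed under scaling because every scalar is of the form \<open>f a'\<close>: surjectivity
  of \<open>f\<close> is what replaces linearity here.
\<close>

lemma subspace_image_iff: "subspace (h ` M) \<longleftrightarrow> subspace M"
proof
  assume M: "subspace M"
  have "a \<odot> h x \<in> h ` M" if "x \<in> M" for a x
  proof -
    obtain a' where "a = f a'"
      using f_aut by (metis field_automorphism_def bij_pointE)
    then have "a \<odot> h x = h (a' \<odot> x)"
      by (simp add: h_scale)
    then show ?thesis
      using M that by (simp add: subspace_scale)
  qed
  moreover have "h x + h y \<in> h ` M" if "x \<in> M" "y \<in> M" for x y
    using M that by (simp add: h_add[symmetric] subspace_add)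
  moreover have "0 \<in> h ` M"
    using subspace_0[OF M] h_0 by (metis imageI)
  ultimately show "subspace (h ` M)"
    by (auto simp: subspace_def)
next
  assume hM: "subspace (h ` M)"
  have mem: "h x \<in> h ` M \<longleftrightarrow> x \<in> M" for x
    using inj_h by (rule inj_image_mem_iff)
  show "subspace M"
    unfolding subspace_def mem[symmetric] h_0 h_add h_scale
    using hM by (simp add: subspace_0 subspace_add subspace_scale)
qed

lemma span_image: "span (h ` S) = h ` span S"
proof
  show "span (h ` S) \<subseteq> h ` span S"
    by (rule span_minimal) (auto simp: subspace_image_iff span_base)
  define U where "U = h -` span (h ` S)"
  have U: "h ` U = span (h ` S)"
    unfolding U_def using bij_h by (simp add: bij_is_surj)
  then have "subspace U"
    using subspace_image_iff[of U] by simp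
  moreover have "S \<subseteq> U"
    by (auto simp: U_def span_base)
  ultimately have "span S \<subseteq> U"
    by (rule span_minimal[rotated])
  then show "h ` span S \<subseteq> span (h ` S)"
    using U by blast
qed

lemma image_eq_UNIV_iff: "h ` M = UNIV \<longleftrightarrow> M = UNIV"
  using bij_h inj_image_eq_iff[OF inj_h, of M UNIV] by (simp add: bij_is_surj)

lemma span_Un_image_iff: "span (h ` M \<union> h ` N) = UNIV \<longleftrightarrow> span (M \<union> N) = UNIV"
  by (simp add: image_Un[symmetric] span_image image_eq_UNIV_iff)

lemma Int_image_iff: "h ` M \<inter> h ` N = {0} \<longleftrightarrow> M \<inter> N = {0}"
  using inj_image_eq_iff[OF inj_h, of "M \<inter> N" "{0}"] by (simp add: image_Int[OF inj_h] h_0)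

lemma complementary_image: "complementary M N \<Longrightarrow> complementary (h ` M) (h ` N)"
  by (simp add: complementary_def subspace_image_iff span_Un_image_iff Int_image_iff)

end

context fin_dim_space
begin

lemma semilinear_bijection_of_bases:
  assumes e: "indexed_basis I e" and b: "indexed_basis I b" and f: "field_automorphism f"
    and h: "\<And>c. h (lincomb I e c) = lincomb I b (\<lambda>i. f (c i))"
  shows "semilinear_bijection scale Basis f h"
proof
  have f_add: "f (x + y) = f x + f y" and f_mult: "f (x * y) = f x * f y" for x y
    using f by (simp_all add: field_automorphism_def)
  have bij_f: "bij f"
    using f by (simp add: field_automorphism_def)
  show "h (x + y) = h x + h y" for x y
  proof -
    obtain c d where "x = lincomb I e c" "y = lincomb I e d"
      using lincomb_exists[OF e] by metis
    then show ?thesis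
      using h[of "\<lambda>i. c i + d i"] by (simp add: h f_add lincomb_add)
  qed
  show "h (a \<odot> x) = f a \<odot> h x" for a x
  proof -
    obtain c where "x = lincomb I e c"
      using lincomb_exists[OF e] by metis
    then show ?thesis
      using h[of "\<lambda>i. a * c i"] by (simp add: h f_mult lincomb_scale)
  qed
  show "bij h"
  proof (rule bijI)
    show "inj h"
    proof (rule injI)
      fix x y assume eq: "h x = h y"
      obtain c d where cd: "x = lincomb I e c" "y = lincomb I e d"
        using lincomb_exists[OF e] by metis
      then have "\<forall>i\<in>I. f (c i) = f (d i)"
        using eq by (simp add: h lincomb_inject[OF b])
      then show "x = y"
        using bij_f cd lincomb_inject[OF e] by (simp add: bij_def inj_eq)
    qed
    show "surj h"
    proof (rule surjI)
      fix y
      have "f (inv f z) = z" for z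
        using bij_f by (simp add: bij_is_surj surj_f_inv_f)
      moreover obtain c where "y = lincomb I b c"
        using lincomb_exists[OF b] by metis
      ultimately have "\<exists>x. h x = y"
        using h[of "\<lambda>i. inv f (c i)"] by auto
      then show "h (SOME x. h x = y) = y"
        by (rule someI_ex)
    qed
  qed
qed (rule f)

text \<open>
  Coordinates in the basis \<open>e\<close> are unique, so prescribing the value on every combination is
  consistent.
\<close>

lemma coordinatewise_map_exists:
  assumes "indexed_basis I e"
  shows "\<exists>h. \<forall>c. h (lincomb I e c) = lincomb I b (\<lambda>i. f (c i))"
proof -
  obtain k where k: "x = lincomb I e (k x)" for x
    using lincomb_exists[OF assms] by metis
  have "lincomb I b (\<lambda>i. f (k (lincomb I e c) i)) = lincomb I b (\<lambda>i. f (c i))" for c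
    using k[of "lincomb I e c"] lincomb_inject[OF assms] by (auto intro: lincomb_cong)
  then show ?thesis
    by (intro exI[of _ "\<lambda>x. lincomb I b (\<lambda>i. f (k x i))"]) simp
qed

end

section \<open>The fundamental theorem of projective geometry\<close>

text \<open>
  A collineation of the projective space, given by a representing vector \<open>T x\<close> for the image of the
  point \<open>span {x}\<close>; only the lines \<open>span {T x}\<close> matter, so \<open>T\<close> need not respect any algebra. The
  assumptions say that incidence with spans is preserved and reflected and that every point is hit.
\<close>

locale collineation = fin_dim_space +
  fixes T :: "'b \<Rightarrow> 'b"
  assumes T_in_span_iff: "T x \<in> span (T ` S) \<longleftrightarrow> x \<in> span S"
    and T_surj: "\<exists>x. span {T x} = span {y}"
begin

lemma T_eq_0_iff: "T x = 0 \<longleftrightarrow> x = 0"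
  using T_in_span_iff[of x "{}"] by simp

lemma T_in_span_single_iff: "T x \<in> span {T y} \<longleftrightarrow> x \<in> span {y}"
  using T_in_span_iff[of x "{y}"] by simp

lemma T_in_span_pair_iff: "T x \<in> span {T y, T z} \<longleftrightarrow> x \<in> span {y, z}"
  using T_in_span_iff[of x "{y, z}"] by simp

lemma span_T_image:
  assumes "span S = UNIV"
  shows "span (T ` S) = UNIV"
proof -
  have "y \<in> span (T ` S)" for y
  proof -
    obtain x where "span {T x} = span {y}"
      using T_surj by blast
    then have "y \<in> span {T x}"
      using span_base by blast
    moreover have "T x \<in> span (T ` S)"
      using assms by (simp add: T_in_span_iff)
    ultimately show ?thesis
      using span_minimal[of "{T x}" "span (T ` S)"] by auto
  qed
  then show ?thesis
    by blast
qed

end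

text \<open>
  Coordinates of the image of a collineation. The index \<open>\<iota>\<close> selects the affine chart of the points
  with \<open>\<iota>\<close>-coordinate \<open>1\<close>; the points with \<open>\<iota>\<close>-coordinate \<open>0\<close> are those at infinity. The
  two further indices \<open>p\<close> and \<open>q\<close> are where dimension at least three enters: addition and
  multiplication of scalars are read off from a plane.
\<close>

locale framed_collineation = collineation +
  fixes I :: "'i set" and e :: "'i \<Rightarrow> 'b" and \<iota> p q :: 'i
  assumes e_basis: "indexed_basis I e"
    and indices: "\<iota> \<in> I" "p \<in> I" "q \<in> I" "p \<noteq> \<iota>" "q \<noteq> \<iota>" "p \<noteq> q"
begin

lemma finite_I: "finite I"
  using e_basis by (simp add: indexed_basis_def)

lemma card_I: "card I = dimension"
  using e_basis dim_span_eq_card_independent[of "e ` I"]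
  by (auto simp: indexed_basis_def card_image dimension_def)

lemma Te_basis: "indexed_basis I (\<lambda>i. T (e i))"
proof -
  have "span ((\<lambda>i. T (e i)) ` I) = UNIV"
    using span_T_image[of "e ` I"] e_basis by (simp add: image_image indexed_basis_def)
  then show ?thesis
    using spanning_family_of_dimension_size[of "\<lambda>i. T (e i)" I] finite_I card_I
    by (simp add: indexed_basis_def)
qed

text \<open>
  The vectors \<open>T (e i)\<close> are determined only up to scalars. The image of the unit point \<open>\<Sum>i. e i\<close>
  fixes these scalars up to a common factor: \<open>b\<close> is scaled so that the unit point of \<open>e\<close> goes to the
  unit point of \<open>b\<close>.
\<close>

definition unit_coords :: "'i \<Rightarrow> 'a" where
  "unit_coords = (SOME t. T (lincomb I e (\<lambda>_. 1)) = lincomb I (\<lambda>i. T (e i)) t)"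

definition b :: "'i \<Rightarrow> 'b" where
  "b i = unit_coords i \<odot> T (e i)"

lemma T_unit: "T (lincomb I e (\<lambda>_. 1)) = lincomb I (\<lambda>i. T (e i)) unit_coords"
  unfolding unit_coords_def by (rule someI_ex[OF lincomb_exists[OF Te_basis]])

lemma T_unit_b: "T (lincomb I e (\<lambda>_. 1)) = lincomb I b (\<lambda>_. 1)"
  unfolding T_unit by (simp add: lincomb_def b_def)

lemma T_lincomb_in_span_iff:
  "T (lincomb I e c) \<in> span ((\<lambda>i. T (e i)) ` J) \<longleftrightarrow> lincomb I e c \<in> span (e ` J)"
  using T_in_span_iff[of _ "e ` J"] by (simp add: image_image)

lemma unit_coords_nonzero:
  assumes "i \<in> I"
  shows "unit_coords i \<noteq> 0"
proof
  assume "unit_coords i = 0"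
  then have "T (lincomb I e (\<lambda>_. 1)) \<in> span ((\<lambda>i. T (e i)) ` (I - {i}))"
    using lincomb_in_span_iff[OF Te_basis, of "I - {i}"] by (auto simp: T_unit)
  then show False
    using lincomb_in_span_iff[OF e_basis, of "I - {i}"] assms by (auto simp: T_lincomb_in_span_iff)
qed

lemma span_b:
  assumes "J \<subseteq> I"
  shows "span (b ` J) = span (T ` e ` J)"
proof (rule span_eq[THEN iffD2], intro conjI subsetI)
  fix x assume "x \<in> b ` J"
  then show "x \<in> span (T ` e ` J)"
    by (auto simp: b_def intro: span_scale span_base)
next
  fix x assume "x \<in> T ` e ` J"
  then obtain i where i: "i \<in> J" "x = T (e i)"
    by blast
  then have "x = inverse (unit_coords i) \<odot> b i"
    using unit_coords_nonzero assms by (auto simp: b_def)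
  then show "x \<in> span (b ` J)"
    using i by (auto intro: span_scale span_base)
qed

lemma b_basis: "indexed_basis I b"
proof -
  have "span (b ` I) = UNIV"
    using span_b[of I] span_T_image[of "e ` I"] e_basis by (simp add: indexed_basis_def)
  then show ?thesis
    using spanning_family_of_dimension_size[of b I] finite_I card_I
    by (simp add: indexed_basis_def)
qed

lemma T_in_span_b_iff:
  assumes "J \<subseteq> I"
  shows "T x \<in> span (b ` J) \<longleftrightarrow> x \<in> span (e ` J)"
  using T_in_span_iff[of x "e ` J"] span_b[OF assms] by simp

lemma T_in_span_insert_b_iff:
  assumes "J \<subseteq> I"
  shows "T x \<in> span (insert (T y) (b ` J)) \<longleftrightarrow> x \<in> span (insert y (e ` J))"
  using T_in_span_iff[of x "insert y (e ` J)"] span_b[OF assms] by (simp add: span_breakdown_eq)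

definition bcoords :: "('i \<Rightarrow> 'a) \<Rightarrow> 'i \<Rightarrow> 'a" where
  "bcoords c = (SOME d. T (lincomb I e c) = lincomb I b d)"

lemma T_lincomb: "T (lincomb I e c) = lincomb I b (bcoords c)"
  unfolding bcoords_def by (rule someI_ex[OF lincomb_exists[OF b_basis]])

text \<open>
  A coordinate vanishes exactly when the vector lies in the span of the other basis vectors, and
  \<open>T\<close> preserves and reflects this.
\<close>

lemma bcoords_eq_0_iff:
  assumes "i \<in> I"
  shows "bcoords c i = 0 \<longleftrightarrow> c i = 0"
  using T_in_span_b_iff[of "I - {i}" "lincomb I e c"] assms
    lincomb_in_span_iff[OF e_basis, of "I - {i}" c]
    lincomb_in_span_iff[OF b_basis, of "I - {i}" "bcoords c"]
  by (auto simp: T_lincomb)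

text \<open>
  If \<open>c\<close> and \<open>d\<close> agree on \<open>J\<close>, then the vector of \<open>c\<close> lies in the span of the vector of \<open>d\<close> and the
  \<open>e i\<close> with \<open>i \<notin> J\<close>. This survives \<open>T\<close>, so the images agree on \<open>J\<close> up to one scalar.
\<close>

lemma bcoords_proportional:
  assumes "J \<subseteq> I" and "\<And>i. i \<in> J \<Longrightarrow> c i = d i"
  shows "\<exists>s. \<forall>i\<in>J. bcoords c i = s * bcoords d i"
proof -
  have *: "I - (I - J) = J"
    using assms(1) by blast
  have "lincomb I e c \<in> span (insert (lincomb I e d) (e ` (I - J)))"
    using lincomb_in_span_insert_iff[OF e_basis, of "I - J" c d] assms(2)
    by (auto simp: * intro!: exI[of _ 1])
  then have "T (lincomb I e c) \<in> span (insert (T (lincomb I e d)) (b ` (I - J)))"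
    by (simp add: T_in_span_insert_b_iff)
  then show ?thesis
    using lincomb_in_span_insert_iff[OF b_basis, of "I - J" "bcoords c" "bcoords d"]
    by (simp add: T_lincomb *)
qed

text \<open>
  For \<open>i \<noteq> \<iota>\<close>, the affine coordinate at \<open>i\<close> of the image of \<open>e \<iota> + a e i\<close>.
\<close>

definition F :: "'i \<Rightarrow> 'a \<Rightarrow> 'a" where
  "F i a = (let d = bcoords (\<lambda>j. if j = i then a else if j = \<iota> then 1 else 0) in d i / d \<iota>)"

text \<open>
  In the affine chart the ratio of the coordinates at \<open>i\<close> and \<open>\<iota>\<close> depends on \<open>c i\<close> alone: compare \<open>c\<close>
  with the vector \<open>e \<iota> + c i e i\<close>, which agrees with it at \<open>\<iota>\<close> and \<open>i\<close>.
\<close>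

lemma bcoords_finite_part:
  assumes "c \<iota> = 1" "i \<in> I" "i \<noteq> \<iota>"
  shows "bcoords c i = bcoords c \<iota> * F i (c i)"
proof -
  define c' where "c' = (\<lambda>j. if j = i then c i else if j = \<iota> then 1 else 0)"
  have "c j = c' j" if "j \<in> {\<iota>, i}" for j
    using that assms by (auto simp: c'_def)
  then obtain s where "\<forall>j\<in>{\<iota>, i}. bcoords c j = s * bcoords c' j"
    using bcoords_proportional[of "{\<iota>, i}" c c'] assms(2) indices(1) by blast
  moreover have "bcoords c' \<iota> \<noteq> 0"
    using bcoords_eq_0_iff[of \<iota> c'] indices assms by (simp add: c'_def)
  moreover have "F i (c i) = bcoords c' i / bcoords c' \<iota>"
    by (simp add: F_def c'_def Let_def)
  ultimately show ?thesis
    by simp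
qed

lemma F_1:
  assumes "i \<in> I" "i \<noteq> \<iota>"
  shows "F i 1 = 1"
proof -
  have "\<forall>j\<in>I. bcoords (\<lambda>_. 1) j = 1"
    using T_lincomb[of "\<lambda>_. 1"] lincomb_inject[OF b_basis] by (simp add: T_unit_b)
  then show ?thesis
    using bcoords_finite_part[of "\<lambda>_. 1" i] assms indices by simp
qed

lemma F_0:
  assumes "i \<in> I" "i \<noteq> \<iota>"
  shows "F i 0 = 0"
proof -
  define c where "c = (\<lambda>j. if j = \<iota> then 1 else 0 :: 'a)"
  have "bcoords c i = 0" "bcoords c \<iota> \<noteq> 0"
    using bcoords_eq_0_iff assms indices by (auto simp: c_def)
  then show ?thesis
    using bcoords_finite_part[of c i] assms by (simp add: c_def)
qed

text \<open>
  Changing the \<open>\<iota>\<close>-coordinate from \<open>0\<close> to \<open>1\<close> leads back to the affine chart without touching the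
  other coordinates.
\<close>

lemma bcoords_at_infinity:
  assumes "c \<iota> = 0"
  shows "\<exists>t. \<forall>i\<in>I - {\<iota>}. bcoords c i = t * F i (c i)"
proof -
  obtain s where "\<forall>i\<in>I - {\<iota>}. bcoords c i = s * bcoords (c(\<iota> := 1)) i"
    using bcoords_proportional[of "I - {\<iota>}" c "c(\<iota> := 1)"] by auto
  then have "\<forall>i\<in>I - {\<iota>}. bcoords c i = s * bcoords (c(\<iota> := 1)) \<iota> * F i (c i)"
    using bcoords_finite_part[of "c(\<iota> := 1)"] by auto
  then show ?thesis
    by blast
qed

text \<open>
  The point \<open>a (e i + e j)\<close> is the same for every \<open>a \<noteq> 0\<close>, and for \<open>a = 1\<close> its image has equal
  coordinates at \<open>i\<close> and \<open>j\<close>.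
\<close>

lemma F_independent_of_index:
  assumes i: "i \<in> I" "i \<noteq> \<iota>" and j: "j \<in> I" "j \<noteq> \<iota>"
  shows "F i a = F j a"
proof (cases "a = 0 \<or> i = j")
  case True
  then show ?thesis
    using F_0 assms by auto
next
  case False
  define c where "c x = (\<lambda>k. if k = i \<or> k = j then x else 0 :: 'a)" for x
  have c: "c x i = x" "c x j = x" for x
    by (simp_all add: c_def)
  obtain t where t: "\<forall>k\<in>I - {\<iota>}. bcoords (c a) k = t * F k (c a k)"
    using bcoords_at_infinity[of "c a"] i j by (auto simp: c_def)
  obtain t1 where t1: "\<forall>k\<in>I - {\<iota>}. bcoords (c 1) k = t1 * F k (c 1 k)"
    using bcoords_at_infinity[of "c 1"] i j by (auto simp: c_def)
  have "lincomb I e (c a) \<in> span {lincomb I e (c 1)}"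
    using lincomb_in_span_single_iff[OF e_basis] by (auto simp: c_def intro!: exI[of _ a])
  then have "T (lincomb I e (c a)) \<in> span {T (lincomb I e (c 1))}"
    by (simp add: T_in_span_single_iff)
  then obtain s where "\<forall>k\<in>I. bcoords (c a) k = s * bcoords (c 1) k"
    using lincomb_in_span_single_iff[OF b_basis] by (auto simp: T_lincomb)
  then have "t * F i a = t * F j a"
    using t t1 i j F_1 by (metis DiffI c insertE emptyE)
  moreover have "bcoords (c a) i \<noteq> 0"
    using bcoords_eq_0_iff[of i "c a"] i(1) False c(1)[of a] by simp
  then have "t \<noteq> 0"
    using t i by auto
  ultimately show ?thesis
    by simp
qed

definition f :: "'a \<Rightarrow> 'a" where
  "f = F p"

lemma F_eq_f: "i \<in> I \<Longrightarrow> i \<noteq> \<iota> \<Longrightarrow> F i a = f a"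
  using F_independent_of_index[of i p] indices by (simp add: f_def)

lemma f_0: "f 0 = 0" and f_1: "f 1 = 1"
  using F_0 F_1 indices by (simp_all add: f_def)

lemma T_lincomb_normalized:
  assumes "c \<iota> = 0 \<or> c \<iota> = 1"
  shows "\<exists>t. T (lincomb I e c) = t \<odot> lincomb I b (\<lambda>i. f (c i))"
proof -
  have "\<exists>t. \<forall>i\<in>I. bcoords c i = t * f (c i)"
  proof (cases "c \<iota> = 1")
    case True
    then have "bcoords c i = bcoords c \<iota> * f (c i)" if "i \<in> I" for i
      using bcoords_finite_part[of c i] that by (cases "i = \<iota>") (simp_all add: f_1 F_eq_f)
    then show ?thesis
      by blast
  next
    case False
    then have c: "c \<iota> = 0"
      using assms by simp
    then obtain t where t: "\<forall>i\<in>I - {\<iota>}. bcoords c i = t * F i (c i)"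
      using bcoords_at_infinity by blast
    have "bcoords c i = t * f (c i)" if "i \<in> I" for i
      using t that c bcoords_eq_0_iff[of \<iota> c]
      by (cases "i = \<iota>") (simp_all add: f_0 F_eq_f)
    then show ?thesis
      by blast
  qed
  then obtain t where "\<forall>i\<in>I. bcoords c i = t * f (c i)"
    by blast
  then have "T (lincomb I e c) = t \<odot> lincomb I b (\<lambda>i. f (c i))"
    by (auto simp: T_lincomb lincomb_scale[symmetric] intro!: lincomb_cong)
  then show ?thesis
    by blast
qed

lemma normalized_span_single:
  assumes mem: "lincomb I e c \<in> span {lincomb I e d}"
    and "c \<iota> = 0 \<or> c \<iota> = 1" "d \<iota> = 0 \<or> d \<iota> = 1"
  shows "\<exists>s. \<forall>i\<in>I. f (c i) = s * f (d i)"
proof (cases "lincomb I e c = 0")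
  case True
  then have "\<forall>i\<in>I. f (c i) = 0 * f (d i)"
    using lincomb_eq_0[OF e_basis True] by (simp add: f_0)
  then show ?thesis
    by blast
next
  case False
  obtain t where t: "T (lincomb I e c) = t \<odot> lincomb I b (\<lambda>i. f (c i))"
    using T_lincomb_normalized assms(2) by blast
  obtain t' where t': "T (lincomb I e d) = t' \<odot> lincomb I b (\<lambda>i. f (d i))"
    using T_lincomb_normalized assms(3) by blast
  have "t \<noteq> 0"
    using False t T_eq_0_iff[of "lincomb I e c"] by auto
  have "T (lincomb I e c) \<in> span {T (lincomb I e d)}"
    using mem by (simp add: T_in_span_single_iff)
  then obtain s where "\<forall>i\<in>I. t * f (c i) = s * (t' * f (d i))"
    using lincomb_in_span_single_iff[OF b_basis, of "\<lambda>i. t * f (c i)" "\<lambda>i. t' * f (d i)"] t t'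
    by (auto simp: lincomb_scale)
  then have "\<forall>i\<in>I. f (c i) = (s * t' / t) * f (d i)"
    using \<open>t \<noteq> 0\<close> by (simp add: field_simps)
  then show ?thesis
    by blast
qed

lemma normalized_span_pair:
  assumes mem: "lincomb I e c \<in> span {lincomb I e d, lincomb I e d'}"
    and "c \<iota> = 0 \<or> c \<iota> = 1" "d \<iota> = 0 \<or> d \<iota> = 1" "d' \<iota> = 0 \<or> d' \<iota> = 1"
  shows "\<exists>s r. \<forall>i\<in>I. f (c i) = s * f (d i) + r * f (d' i)"
proof (cases "lincomb I e c = 0")
  case True
  then have "\<forall>i\<in>I. f (c i) = 0 * f (d i) + 0 * f (d' i)"
    using lincomb_eq_0[OF e_basis True] by (simp add: f_0)
  then show ?thesis
    by blast
next
  case False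
  obtain t where t: "T (lincomb I e c) = t \<odot> lincomb I b (\<lambda>i. f (c i))"
    using T_lincomb_normalized assms(2) by blast
  obtain t' where t': "T (lincomb I e d) = t' \<odot> lincomb I b (\<lambda>i. f (d i))"
    using T_lincomb_normalized assms(3) by blast
  obtain t'' where t'': "T (lincomb I e d') = t'' \<odot> lincomb I b (\<lambda>i. f (d' i))"
    using T_lincomb_normalized assms(4) by blast
  have "t \<noteq> 0"
    using False t T_eq_0_iff[of "lincomb I e c"] by auto
  have "T (lincomb I e c) \<in> span {T (lincomb I e d), T (lincomb I e d')}"
    using mem by (simp add: T_in_span_pair_iff)
  then obtain s r where "\<forall>i\<in>I. t * f (c i) = s * (t' * f (d i)) + r * (t'' * f (d' i))"
    using lincomb_in_span_pair_iff[OF b_basis, of "\<lambda>i. t * f (c i)" "\<lambda>i. t' * f (d i)"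
        "\<lambda>i. t'' * f (d' i)"] t t' t''
    by (auto simp: lincomb_scale)
  then have "\<forall>i\<in>I. f (c i) = (s * t' / t) * f (d i) + (r * t'' / t) * f (d' i)"
    using \<open>t \<noteq> 0\<close> by (simp add: field_simps)
  then show ?thesis
    by blast
qed

text \<open>
  The vector \<open>e \<iota> + (x + y) e p + e q\<close> is the sum of \<open>e \<iota> + x e p\<close> and \<open>y e p + e q\<close>, hence its image
  lies on the line through their images. The coordinates at \<open>\<iota>\<close> and \<open>q\<close> force both coefficients to
  be \<open>1\<close>, and the coordinate at \<open>p\<close> is the claim.
\<close>

lemma f_add: "f (x + y) = f x + f y"
proof -
  define c where "c = (\<lambda>i. if i = \<iota> then 1 else if i = p then x else 0)"
  define d where "d = (\<lambda>i. if i = p then y else if i = q then 1 else 0)"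
  have "lincomb I e (\<lambda>i. c i + d i) \<in> span {lincomb I e c, lincomb I e d}"
    unfolding lincomb_add by (intro span_add span_base) auto
  then obtain s r where "\<forall>i\<in>I. f (c i + d i) = s * f (c i) + r * f (d i)"
    using normalized_span_pair[of "\<lambda>i. c i + d i" c d] indices by (auto simp: c_def d_def)
  then have "f (c \<iota> + d \<iota>) = s * f (c \<iota>) + r * f (d \<iota>)" "f (c p + d p) = s * f (c p) + r * f (d p)"
    "f (c q + d q) = s * f (c q) + r * f (d q)"
    using indices by auto
  then show ?thesis
    using indices by (simp add: c_def d_def f_0 f_1)
qed

text \<open>
  The vector \<open>x y e p + x e q\<close> represents the same point as \<open>y e p + e q\<close>. In the images the
  coordinate at \<open>q\<close> gives the factor of proportionality \<open>f x\<close>.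
\<close>

lemma f_mult: "f (x * y) = f x * f y"
proof -
  define d where "d = (\<lambda>i. if i = p then y else if i = q then 1 else 0)"
  have "lincomb I e (\<lambda>i. x * d i) \<in> span {lincomb I e d}"
    unfolding lincomb_scale by (intro span_scale span_base) auto
  then obtain s where "\<forall>i\<in>I. f (x * d i) = s * f (d i)"
    using normalized_span_single[of "\<lambda>i. x * d i" d] indices by (auto simp: d_def)
  then have "f (x * d p) = s * f (d p)" "f (x * d q) = s * f (d q)"
    using indices by auto
  then show ?thesis
    using indices by (simp add: d_def f_1)
qed

lemma f_eq_0: "f x = 0 \<Longrightarrow> x = 0"
  using f_mult[of x "inverse x"] by (cases "x = 0") (simp_all add: f_1)

text \<open>
  Rescaling the \<open>\<iota>\<close>-coordinate to \<open>1\<close> changes neither the point nor, since \<open>f\<close> is multiplicative,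
  the line of the claimed image.
\<close>

lemma T_lincomb_f: "\<exists>t. T (lincomb I e c) = t \<odot> lincomb I b (\<lambda>i. f (c i))"
proof (cases "c \<iota> = 0")
  case True
  then show ?thesis
    using T_lincomb_normalized by blast
next
  case False
  define d where "d = (\<lambda>i. inverse (c \<iota>) * c i)"
  have c: "c i = c \<iota> * d i" for i
    using False by (simp add: d_def)
  have "lincomb I e c = c \<iota> \<odot> lincomb I e d"
    by (simp add: lincomb_scale[symmetric] c[symmetric])
  then have "lincomb I e c \<in> span {lincomb I e d}"
    by (simp add: span_scale span_base)
  then have "T (lincomb I e c) \<in> span {T (lincomb I e d)}"
    by (simp add: T_in_span_single_iff)
  then obtain s where s: "T (lincomb I e c) = s \<odot> T (lincomb I e d)"
    by (auto simp: span_singleton)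
  obtain t where t: "T (lincomb I e d) = t \<odot> lincomb I b (\<lambda>i. f (d i))"
    using T_lincomb_normalized[of d] False by (auto simp: d_def)
  have "lincomb I b (\<lambda>i. f (c i)) = f (c \<iota>) \<odot> lincomb I b (\<lambda>i. f (d i))"
    by (subst c) (simp add: f_mult lincomb_scale)
  moreover have "f (c \<iota>) \<noteq> 0"
    using False f_eq_0 by blast
  ultimately have "lincomb I b (\<lambda>i. f (d i)) = inverse (f (c \<iota>)) \<odot> lincomb I b (\<lambda>i. f (c i))"
    by simp
  then have "T (lincomb I e c) = (s * t * inverse (f (c \<iota>))) \<odot> lincomb I b (\<lambda>i. f (c i))"
    using s t by simp
  then show ?thesis
    by blast
qed

lemma f_surj: "\<exists>x. f x = y"
proof -
  define d where "d = (\<lambda>i. if i = \<iota> then 1 else if i = p then y else 0)"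
  obtain x where x: "span {T x} = span {lincomb I b d}"
    using T_surj by blast
  obtain c where c: "x = lincomb I e c"
    using lincomb_exists[OF e_basis] by blast
  obtain t where t: "T x = t \<odot> lincomb I b (\<lambda>i. f (c i))"
    using T_lincomb_f c by blast
  have "lincomb I b d \<in> span {T x}"
    using x span_base by blast
  then obtain s where "lincomb I b d = s \<odot> T x"
    by (auto simp: span_singleton)
  then have "lincomb I b d = lincomb I b (\<lambda>i. s * t * f (c i))"
    using t by (simp add: lincomb_scale)
  then have d: "\<forall>i\<in>I. d i = s * t * f (c i)"
    by (rule lincomb_inject[OF b_basis, THEN iffD1])
  then have *: "1 = s * t * f (c \<iota>)" "y = s * t * f (c p)"
    using indices by (auto simp: d_def)
  then have "c \<iota> \<noteq> 0"
    by (auto simp: f_0)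
  then have "f (c \<iota>) * f (inverse (c \<iota>)) = 1"
    by (simp add: f_mult[symmetric] f_1)
  then have "f (c p * inverse (c \<iota>)) = y"
    using * by (simp add: f_mult) algebra
  then show ?thesis
    by blast
qed

lemma f_bij: "bij f"
proof (rule bijI)
  show "inj f"
  proof (rule injI)
    fix x y assume "f x = f y"
    then have "f (x - y) = 0"
      using f_add[of "x - y" y] by simp
    then show "x = y"
      using f_eq_0 by fastforce
  qed
  show "surj f"
    using f_surj by (metis surjI)
qed

end

theorem (in collineation) fundamental_theorem_projective_geometry:
  assumes e: "indexed_basis I e" and I: "3 \<le> card I"
  shows "\<exists>b f. indexed_basis I b \<and> field_automorphism f
    \<and> (\<forall>c. span {T (lincomb I e c)} = span {lincomb I b (\<lambda>i. f (c i))})"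
proof -
  obtain J where J: "J \<subseteq> I" "card J = 3"
    using I obtain_subset_with_card_n by metis
  then obtain \<iota> p q where "J = {\<iota>, p, q}" "\<iota> \<noteq> p" "\<iota> \<noteq> q" "p \<noteq> q"
    using card_3_iff by metis
  then interpret framed_collineation scale Basis T I e \<iota> p q
    using e J by unfold_locales auto
  have "span {T (lincomb I e c)} = span {lincomb I b (\<lambda>i. f (c i))}" for c
  proof -
    obtain t where t: "T (lincomb I e c) = t \<odot> lincomb I b (\<lambda>i. f (c i))"
      using T_lincomb_f by blast
    show ?thesis
    proof (cases "t = 0")
      case True
      then have "lincomb I e c = 0"
        using t T_eq_0_iff by simp
      then have "\<forall>i\<in>I. c i = 0"
        using lincomb_eq_0[OF e] by blast
      then have "lincomb I b (\<lambda>i. f (c i)) = 0"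
        by (simp add: lincomb_def f_0)
      then show ?thesis
        using t by simp
    next
      case False
      then show ?thesis
        using t span_image_scale[of "{lincomb I b (\<lambda>i. f (c i))}" "\<lambda>_. t"] by simp
    qed
  qed
  then show ?thesis
    using b_basis f_bij f_add f_mult unfolding field_automorphism_def by blast
qed

section \<open>Maps that preserve spanning and complementary pairs of subspaces\<close>

text \<open>
  What shrinking the joint spectrum says about ranges: the assumption on spanning pairs comes from the
  point \<open>[1, 1]\<close> of the spectrum, the one on complementary pairs from \<open>[1, -1]\<close>.
\<close>

locale complement_preserving = fin_dim_space +
  fixes \<Phi> :: "'b set \<Rightarrow> 'b set"
  assumes \<Phi>_surj: "\<Phi> ` Collect subspace = Collect subspace"
    and \<Phi>_sum: "subspace M \<Longrightarrow> subspace N \<Longrightarrow> span (M \<union> N) = UNIV \<Longrightarrow> span (\<Phi> M \<union> \<Phi> N) = UNIV"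
    and \<Phi>_complementary: "complementary M N \<Longrightarrow> complementary (\<Phi> M) (\<Phi> N)"
begin

lemma subspace_\<Phi>: "subspace M \<Longrightarrow> subspace (\<Phi> M)"
  using \<Phi>_surj by blast

lemma \<Phi>_preimage:
  assumes "subspace N"
  obtains M where "subspace M" "N = \<Phi> M"
  using assms \<Phi>_surj by blast

text \<open>
  Subspaces of equal dimension have a common complement, and their images are complements of its
  image.
\<close>

lemma dim_\<Phi>_determined_by_dim:
  assumes "subspace M" "subspace M'" "dim M = dim M'"
  shows "dim (\<Phi> M) = dim (\<Phi> M')"
proof -
  obtain N where "complementary M N" "complementary M' N"
    using common_complement assms by blast
  then have "complementary (\<Phi> M) (\<Phi> N)" "complementary (\<Phi> M') (\<Phi> N)"
    by (simp_all add: \<Phi>_complementary)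
  then show ?thesis
    using complementary_dim by (metis add_right_cancel)
qed

lemma dim_\<Phi>_mono:
  assumes M: "subspace M" and M': "subspace M'" and le: "dim M \<le> dim M'"
  shows "dim (\<Phi> M) \<le> dim (\<Phi> M')"
proof -
  obtain S where S: "subspace S" "S \<subseteq> M'" "dim S = dim M"
    using choose_subspace_of_subspace[OF le] M' by (auto simp: span_eq_iff[THEN iffD2])
  obtain N where N: "complementary S N"
    using common_complement[OF S(1) S(1)] by blast
  have "span (S \<union> N) \<subseteq> span (M' \<union> N)"
    using S(2) by (intro span_mono) blast
  then have "span (M' \<union> N) = UNIV"
    using complementaryD(3)[OF N] by blast
  then have "span (\<Phi> M' \<union> \<Phi> N) = UNIV"
    using \<Phi>_sum M' complementaryD(2)[OF N] by simp
  then have "dimension \<le> dim (\<Phi> M') + dim (\<Phi> N)"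
    using subspace_\<Phi>[OF M'] subspace_\<Phi>[OF complementaryD(2)[OF N]] by (simp add: dimension_le_dim_sum)
  moreover have "dim (\<Phi> S) + dim (\<Phi> N) = dimension"
    using N by (simp add: \<Phi>_complementary complementary_dim)
  ultimately show ?thesis
    using dim_\<Phi>_determined_by_dim[OF S(1) M S(3)] by simp
qed

text \<open>
  The dimension of \<open>\<Phi> M\<close> is a function of the dimension of \<open>M\<close>; this function is monotone, and by
  surjectivity of \<open>\<Phi>\<close> it maps \<open>{..dimension}\<close> onto itself. Hence it is the identity.
\<close>

lemma dim_\<Phi>:
  assumes M: "subspace M"
  shows "dim (\<Phi> M) = dim M"
proof -
  define V where "V k = (SOME S. subspace S \<and> dim S = k)" for k
  have "\<exists>S. subspace S \<and> dim S = k" if "k \<le> dimension" for k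
    using choose_subspace_of_subspace[of k UNIV] that by (auto simp: dimension_def)
  then have V: "subspace (V k)" "dim (V k) = k" if "k \<le> dimension" for k
    using someI_ex[of "\<lambda>S. subspace S \<and> dim S = k"] that unfolding V_def by auto
  have M_V: "dim (\<Phi> S) = dim (\<Phi> (V (dim S)))" if "subspace S" for S
    using dim_\<Phi>_determined_by_dim[OF that] V[OF dim_subset_UNIV, of S] by simp
  have "dim (\<Phi> (V (dim M))) = dim M"
  proof (rule mono_surj_atMost_is_id[where d = "\<lambda>k. dim (\<Phi> (V k))" and n = dimension])
    show "(\<lambda>k. dim (\<Phi> (V k))) ` {..dimension} = {..dimension}"
    proof (intro equalityI subsetI)
      fix k assume "k \<in> {..dimension}"
      then have k: "k \<le> dimension"
        by simp
      then obtain S where S: "subspace S" "V k = \<Phi> S"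
        using \<Phi>_preimage V by metis
      then have "k = dim (\<Phi> (V (dim S)))"
        using M_V[OF S(1)] V(2)[OF k] by metis
      then show "k \<in> (\<lambda>k. dim (\<Phi> (V k))) ` {..dimension}"
        using dim_subset_UNIV[of S] by blast
    qed (use dim_subset_UNIV in auto)
    show "dim (\<Phi> (V i)) \<le> dim (\<Phi> (V j))" if "i \<le> j" "j \<le> dimension" for i j
      using dim_\<Phi>_mono V that by simp
  qed (rule dim_subset_UNIV)
  then show ?thesis
    using M_V[OF M] by metis
qed

text \<open>
  Since \<open>\<Phi>\<close> maps points to points, it is represented on them by a map of vectors.
\<close>

definition T :: "'b \<Rightarrow> 'b" where
  "T x = (SOME y. \<Phi> (span {x}) = span {y})"

lemma \<Phi>_line: "\<Phi> (span {x}) = span {T x}"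
proof -
  have "dim (\<Phi> (span {x})) \<le> 1"
    by (simp add: dim_\<Phi>)
  then obtain y where "\<Phi> (span {x}) = span {y}"
    using subspace_dim_le_1_eq_span subspace_\<Phi> by (metis subspace_span)
  then show ?thesis
    unfolding T_def by (rule someI)
qed

lemma T_eq_0_iff: "T x = 0 \<longleftrightarrow> x = 0"
  using dim_\<Phi>[of "span {x}"] \<Phi>_line[of x] by (auto split: if_splits)

lemma T_in_\<Phi>_line: "T x \<in> \<Phi> (span {x})"
  by (simp add: \<Phi>_line span_base)

text \<open>
  A point outside a hyperplane is a complement of it, so incidence of a point with a hyperplane is
  reflected by \<open>\<Phi>\<close>. The incidence properties of \<open>T\<close> are derived from this and from
  surjectivity.
\<close>

lemma T_in_\<Phi>_hyperplane:
  assumes "complementary K L" "dim K + 1 = dimension" "T x \<in> \<Phi> K"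
  shows "x \<in> K"
proof (rule ccontr)
  assume x: "x \<notin> K"
  have K: "subspace K"
    using assms(1) by (simp add: complementary_def)
  then have "complementary K (span {x})"
    using x assms(2) by (simp add: hyperplane_complementary_line)
  then have "\<Phi> K \<inter> \<Phi> (span {x}) = {0}"
    by (rule complementaryD(4)[OF \<Phi>_complementary])
  then have "x = 0"
    using assms(3) T_in_\<Phi>_line T_eq_0_iff by blast
  then show False
    using x K subspace_0 by blast
qed

lemma line_subset_iff: "subspace N \<Longrightarrow> span {x} \<subseteq> N \<longleftrightarrow> x \<in> N"
  using span_minimal[of "{x}" N] span_base[of x "{x}"] by auto

lemma T_surj: "\<exists>x. span {T x} = span {y}"
proof -
  obtain M where M: "subspace M" "span {y} = \<Phi> M"
    using \<Phi>_preimage subspace_span by metis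
  then have "dim M = dim (span {y})"
    using dim_\<Phi> by simp
  then have "dim M \<le> 1"
    by simp
  then obtain x where "M = span {x}"
    using subspace_dim_le_1_eq_span M(1) by blast
  then show ?thesis
    using M \<Phi>_line by auto
qed

text \<open>
  Otherwise the image lies in a hyperplane, which is \<open>\<Phi> K\<close> for a hyperplane \<open>K\<close>, and then \<open>S\<close> lies in
  \<open>K\<close>.
\<close>

lemma span_T_image_of_spanning:
  assumes "span S = UNIV"
  shows "span (T ` S) = UNIV"
proof (rule ccontr)
  assume "span (T ` S) \<noteq> UNIV"
  then obtain y where y: "y \<notin> span (T ` S)"
    by blast
  then obtain J where J: "span (T ` S) \<subseteq> J" "complementary J (span {y})"
    using hyperplane_separating subspace_span by metis
  have "y \<noteq> 0"
    using y span_zero by metis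
  then have dim_J: "dim J + 1 = dimension"
    using complementary_dim[OF J(2)] by simp
  obtain K where K: "subspace K" "J = \<Phi> K"
    using \<Phi>_preimage[OF complementaryD(1)[OF J(2)]] by blast
  then have dim_K: "dim K + 1 = dimension"
    using dim_J dim_\<Phi> by simp
  obtain L where "complementary K L"
    using common_complement[OF K(1) K(1)] by blast
  then have "x \<in> K" if "x \<in> S" for x
    using T_in_\<Phi>_hyperplane[OF _ dim_K] that J(1) K(2) span_base by blast
  then have "K = UNIV"
    using assms span_minimal[of S K] K(1) by auto
  then show False
    using dim_K by (simp add: dimension_def)
qed

text \<open>
  Extend \<open>S\<close> to a basis: its image spans and has at most as many elements as the dimension.
\<close>

lemma T_image_of_independent:
  assumes S: "independent S"
  shows "inj_on T S" "independent (T ` S)"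
proof -
  define B where "B = extend_basis S"
  have B: "S \<subseteq> B" "independent B" "span B = UNIV"
    unfolding B_def using S by (auto simp: extend_basis_superset independent_extend_basis)
  then have "finite B" "card B = dimension"
    using finiteI_independent dim_span_eq_card_independent[of B] by (auto simp: dimension_def)
  then have "inj_on T B" "independent (T ` B)"
    using spanning_family_of_dimension_size[of T B] span_T_image_of_spanning B(3) by auto
  then show "inj_on T S" "independent (T ` S)"
    using B(1) inj_on_subset independent_mono by (blast, metis image_mono)
qed

lemma T_not_in_span_if_independent:
  assumes "independent (insert z S)" "z \<notin> S"
  shows "T z \<notin> span (T ` S)"
proof -
  have inj: "inj_on T (insert z S)" and ind: "independent (T ` insert z S)"
    by (rule T_image_of_independent[OF assms(1)])+
  then have "T z \<notin> T ` S"
    using assms(2) by (auto simp: inj_on_def)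
  then show ?thesis
    using ind by (simp add: independent_insert)
qed

lemma T_in_span_single:
  assumes "y \<in> span {x}"
  shows "T y \<in> span {T x}"
proof (cases "y = 0")
  case True
  then show ?thesis
    using span_zero[of "{T x}"] T_eq_0_iff[of 0] by simp
next
  case False
  then obtain a where a: "y = a \<odot> x" "a \<noteq> 0"
    using assms by (auto simp: span_singleton)
  then have "span {y} = span {x}"
    using span_image_scale[of "{x}" "\<lambda>_. a"] by simp
  then show ?thesis
    using T_in_\<Phi>_line \<Phi>_line by metis
qed

lemma T_in_span_pair_imp:
  assumes "T z \<in> span {T x, T y}"
  shows "z \<in> span {x, y}"
proof -
  obtain S where S: "S \<subseteq> {x, y}" "independent S" "{x, y} \<subseteq> span S"
    using maximal_independent_subset by blast
  have span_S: "span S = span {x, y}"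
    using S by (metis span_mono span_minimal subspace_span subset_antisym)
  have T_S: "{T x, T y} \<subseteq> span (T ` S)"
  proof (cases "S = {x, y}")
    case True
    then show ?thesis
      by (auto intro: span_base)
  next
    case False
    then consider "S = {}" | "S = {x}" | "S = {y}"
      using S(1) by blast
    then show ?thesis
    proof cases
      case 1
      then show ?thesis
        using S(3) by (auto simp: T_eq_0_iff)
    qed (use S(3) T_in_span_single in auto)
  qed
  show ?thesis
  proof (rule ccontr)
    assume "z \<notin> span {x, y}"
    then have "z \<notin> span S"
      by (simp add: span_S)
    then have "T z \<notin> span (T ` S)"
      using T_not_in_span_if_independent[of z S] S(2) independent_insertI span_base by blast
    then show False
      using assms span_minimal[OF T_S] by auto
  qed
qed

text \<open>
  Induction on \<open>S\<close> reduces incidence with a span to incidence with a line: \<open>T z\<close> lies on a line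
  through \<open>T x\<close> and a point of \<open>span (T ` S)\<close>, and surjectivity writes this second point as \<open>T y\<close>.
\<close>

lemma T_in_span_imp:
  assumes "finite S" "T z \<in> span (T ` S)"
  shows "z \<in> span S"
  using assms
proof (induction S arbitrary: z rule: finite_induct)
  case empty
  then show ?case
    by (simp add: T_eq_0_iff)
next
  case (insert x S)
  then obtain a where a: "T z - a \<odot> T x \<in> span (T ` S)"
    using span_breakdown_eq[of "T z" "T x" "T ` S"] by auto
  obtain y where y: "span {T y} = span {T z - a \<odot> T x}"
    using T_surj by blast
  then have "T y \<in> span {T z - a \<odot> T x}" and 1: "T z - a \<odot> T x \<in> span {T y}"
    using span_base by blast+
  then have "T y \<in> span (T ` S)"
    using a span_minimal[of "{T z - a \<odot> T x}" "span (T ` S)"] by auto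
  then have "y \<in> span S"
    by (rule insert.IH)
  then have "{x, y} \<subseteq> span (insert x S)"
    using span_mono[of S "insert x S"] span_base by blast
  moreover have "T z \<in> span {T x, T y}"
    using 1 span_breakdown_eq[of "T z" "T x" "{T y}"] by blast
  then have "z \<in> span {x, y}"
    by (rule T_in_span_pair_imp)
  ultimately show ?case
    using span_minimal[of "{x, y}" "span (insert x S)"] by auto
qed

text \<open>
  The converse is an exchange argument. Extend a basis \<open>S'\<close> of \<open>span S\<close> to a basis \<open>B\<close> of the space
  and expand \<open>T z\<close> in the basis \<open>T ` B\<close>. If some \<open>v \<in> B - S'\<close> occurred, then \<open>T v\<close> would lie in the span
  of \<open>T z\<close> and the images of the other basis vectors; reflecting this puts \<open>v\<close> into
  \<open>span (insert z (B - {v}))\<close>, which is \<open>span (B - {v})\<close> because of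
  \<open>z \<in> span S'\<close>, and contradicts the independence of \<open>B\<close>.
\<close>

lemma T_in_span:
  assumes "z \<in> span S"
  shows "T z \<in> span (T ` S)"
proof -
  obtain S' where S': "S' \<subseteq> S" "independent S'" "S \<subseteq> span S'"
    using maximal_independent_subset by blast
  have z: "z \<in> span S'"
    using assms S'(3) span_minimal[of S "span S'"] by auto
  define B where "B = extend_basis S'"
  have B: "S' \<subseteq> B" "independent B" "span B = UNIV"
    unfolding B_def using S' by (auto simp: extend_basis_superset independent_extend_basis)
  have fin: "finite B"
    using B finiteI_independent by blast
  have span_T_B: "span (T ` B) = UNIV"
    by (rule span_T_image_of_spanning[OF B(3)])
  have inj: "inj_on T B"
    by (rule T_image_of_independent[OF B(2)])
  obtain c where c: "T z = (\<Sum>v\<in>T ` B. c v \<odot> v)"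
    using span_finite[of "T ` B"] fin span_T_B UNIV_I[of "T z"] by auto
  then have Tz: "T z = (\<Sum>v\<in>B. c (T v) \<odot> T v)"
    using inj by (simp add: sum.reindex)
  have "c (T v) = 0" if v: "v \<in> B - S'" for v
  proof (rule ccontr)
    assume nz: "c (T v) \<noteq> 0"
    let ?W = "insert z (B - {v})"
    have "T z = c (T v) \<odot> T v + (\<Sum>w\<in>B - {v}. c (T w) \<odot> T w)"
      using Tz v fin sum.remove[of B v] by simp
    then have Tv: "T v = inverse (c (T v)) \<odot> (T z - (\<Sum>w\<in>B - {v}. c (T w) \<odot> T w))"
      using nz by simp
    have "T v \<in> span (T ` ?W)"
      by (subst Tv, intro span_diff span_sum span_scale span_base) auto
    then have "v \<in> span ?W"
      by (rule T_in_span_imp[rotated]) (simp add: fin)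
    moreover have "z \<in> span (B - {v})"
      using z span_mono[of S' "B - {v}"] v B(1) by blast
    ultimately have "v \<in> span (B - {v})"
      by (simp add: span_redundant)
    then show False
      using B(2) v dependent_def by blast
  qed
  then have "T z = (\<Sum>v\<in>S'. c (T v) \<odot> T v)"
    unfolding Tz using fin B(1) by (intro sum.mono_neutral_right) auto
  then have "T z \<in> span (T ` S')"
    by (simp only:) (intro span_sum span_scale span_base imageI)
  then show ?thesis
    using span_mono[of "T ` S'" "T ` S"] S'(1) by blast
qed

lemma collineation_T: "collineation scale Basis T"
proof unfold_locales
  show "T x \<in> span (T ` S) \<longleftrightarrow> x \<in> span S" for x S
  proof
    assume x: "T x \<in> span (T ` S)"
    obtain S' where S': "S' \<subseteq> S" "independent S'" "S \<subseteq> span S'"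
      using maximal_independent_subset by blast
    have "T ` S \<subseteq> span (T ` S')"
      using S'(3) T_in_span by blast
    then have "T x \<in> span (T ` S')"
      using x span_minimal[of "T ` S" "span (T ` S')"] by auto
    then have "x \<in> span S'"
      using T_in_span_imp[OF finiteI_independent[OF S'(2)]] by simp
    then show "x \<in> span S"
      using S'(1) span_mono by blast
  qed (rule T_in_span)
  show "\<exists>x. span {T x} = span {y}" for y
    by (rule T_surj)
qed

lemma \<Phi>_subset_imp:
  assumes "complementary K L" "dim K + 1 = dimension" "subspace M" "\<Phi> M \<subseteq> \<Phi> K"
  shows "M \<subseteq> K"
proof (rule ccontr)
  assume "\<not> M \<subseteq> K"
  then obtain x where x: "x \<in> M" "x \<notin> K"
    by blast
  have K: "subspace K"
    using assms(1) by (simp add: complementary_def)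
  then have "span (K \<union> span {x}) = UNIV"
    using hyperplane_complementary_line[OF K assms(2) x(2)] by (simp add: complementary_def)
  moreover have "span {x} \<subseteq> M"
    using x(1) assms(3) by (simp add: span_minimal)
  ultimately have "span (K \<union> M) = UNIV"
    using span_mono[of "K \<union> span {x}" "K \<union> M"] by blast
  then have "span (\<Phi> K \<union> \<Phi> M) = UNIV"
    using \<Phi>_sum K assms(3) by blast
  moreover have "\<Phi> K \<union> \<Phi> M = \<Phi> K"
    using assms(4) by blast
  ultimately have "\<Phi> K = UNIV"
    using subspace_\<Phi>[OF K] span_eq_iff[of "\<Phi> K"] by simp
  then show False
    using assms(2) dim_\<Phi>[OF K] by (simp add: dimension_def)
qed

text \<open>
  So far the semilinear map describes \<open>\<Phi>\<close> on points only. For a hyperplane, \<open>\<Phi> K \<subseteq> h ` K\<close> by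
  reflection of incidence, and passing to a complementary point gives equality. A general \<open>h ` M\<close>
  is contained in \<open>\<Phi> M\<close> because every hyperplane that contains \<open>\<Phi> M\<close> is \<open>\<Phi> K\<close> with \<open>M \<subseteq> K\<close>, and
  equality follows from the same inclusion for a complement.
\<close>

theorem eq_image_of_semilinear_lift:
  assumes h: "semilinear_bijection scale Basis f h" and h_line: "\<And>x. span {T x} = span {h x}"
    and M: "subspace M"
  shows "\<Phi> M = h ` M"
proof -
  interpret h: semilinear_bijection scale Basis f h
    by (rule h)
  have hT: "T x \<in> N \<longleftrightarrow> h x \<in> N" if "subspace N" for x N
    using h_line[of x] line_subset_iff[OF that] by metis
  have hyperplane: "\<Phi> K = h ` K" if c: "complementary K (span {x})" and x: "x \<noteq> 0" for K x
  proof (rule complementary_eqI)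
    have K: "subspace K" and dim_K: "dim K + 1 = dimension"
      using c complementary_dim[OF c] x by (simp_all add: complementary_def)
    show "complementary (\<Phi> K) (\<Phi> (span {x}))"
      using c by (rule \<Phi>_complementary)
    show "complementary (h ` K) (h ` span {x})"
      using c by (rule h.complementary_image)
    show "\<Phi> K \<subseteq> h ` K"
    proof
      fix y assume y: "y \<in> \<Phi> K"
      obtain u where u: "y = h u"
        using h.bij_h by (metis bij_pointE)
      then have "T u \<in> \<Phi> K"
        using y hT subspace_\<Phi> K by blast
      then show "y \<in> h ` K"
        using T_in_\<Phi>_hyperplane[OF c dim_K] u by blast
    qed
    have "span {h x} \<subseteq> h ` span {x}"
      by (rule span_minimal) (simp_all add: h.subspace_image_iff span_base)
    then show "\<Phi> (span {x}) \<subseteq> h ` span {x}"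
      by (simp add: \<Phi>_line h_line)
  qed
  have sub: "h ` M \<subseteq> \<Phi> M" if M: "subspace M" for M
  proof (rule ccontr)
    assume "\<not> h ` M \<subseteq> \<Phi> M"
    then obtain x where x: "x \<in> M" "h x \<notin> \<Phi> M"
      by blast
    then obtain J where J: "\<Phi> M \<subseteq> J" "complementary J (span {h x})" "h x \<notin> J"
      using hyperplane_separating subspace_\<Phi>[OF M] by metis
    define K where "K = h -` J"
    have K: "J = h ` K"
      unfolding K_def using h.bij_h by (simp add: bij_is_surj)
    have sJ: "subspace J"
      using J(2) by (simp add: complementary_def)
    then have sK: "subspace K"
      using K h.subspace_image_iff by simp
    have xK: "x \<notin> K"
      using J(3) K by blast
    have "x \<noteq> 0"
      using xK subspace_0[OF sK] by blast
    \<comment> \<open>Extend the preimage \<open>K\<close> of \<open>J\<close> to a hyperplane \<open>K'\<close> that misses \<open>x\<close>. As \<open>J\<close> is already a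
      complement of the point \<open>span {h x}\<close>, it equals \<open>h ` K'\<close>.\<close>
    obtain K' where K': "K \<subseteq> K'" "complementary K' (span {x})" "x \<notin> K'"
      using hyperplane_separating[OF sK xK] by blast
    have "J = h ` K'"
    proof (rule complementary_eqI[OF J(2) h.complementary_image[OF K'(2)]])
      show "J \<subseteq> h ` K'"
        using K K'(1) by blast
      show "span {h x} \<subseteq> h ` span {x}"
        by (rule span_minimal) (simp_all add: h.subspace_image_iff span_base)
    qed
    then have "\<Phi> M \<subseteq> \<Phi> K'"
      using J(1) hyperplane[OF K'(2) \<open>x \<noteq> 0\<close>] by simp
    moreover have "dim K' + 1 = dimension"
      using complementary_dim[OF K'(2)] \<open>x \<noteq> 0\<close> by simp
    ultimately have "M \<subseteq> K'"
      using \<Phi>_subset_imp[OF K'(2)] M by blast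
    then show False
      using x(1) K'(3) by blast
  qed
  obtain N where N: "complementary M N"
    using common_complement[OF M M] by blast
  have "h ` M = \<Phi> M"
    using complementary_eqI[OF h.complementary_image[OF N] \<Phi>_complementary[OF N]] sub[OF M] sub[of N] N
    by (simp add: complementary_def)
  then show ?thesis
    by simp
qed

theorem semilinear_representation:
  assumes e: "indexed_basis I e" and I: "3 \<le> card I"
  obtains b f h where "indexed_basis I b" "field_automorphism f"
    "\<And>c. h (lincomb I e c) = lincomb I b (\<lambda>i. f (c i))"
    "\<And>M. subspace M \<Longrightarrow> \<Phi> M = h ` M"
proof -
  obtain b f where b: "indexed_basis I b" and f: "field_automorphism f"
    and bf: "\<And>c. span {T (lincomb I e c)} = span {lincomb I b (\<lambda>i. f (c i))}"
    using collineation.fundamental_theorem_projective_geometry[OF collineation_T e I] by blast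
  obtain h where h: "\<And>c. h (lincomb I e c) = lincomb I b (\<lambda>i. f (c i))"
    using coordinatewise_map_exists[OF e] by metis
  have "span {T x} = span {h x}" for x
    using bf h lincomb_exists[OF e, of x] by auto
  then have "\<Phi> M = h ` M" if "subspace M" for M
    using eq_image_of_semilinear_lift semilinear_bijection_of_bases[OF e b f h] that by blast
  then show ?thesis
    using that b f h by blast
qed

end

section \<open>Orthonormal families in a complex Hilbert space\<close>

abbreviation csubspace :: "'a::chilbert_space set \<Rightarrow> bool" where
  "csubspace \<equiv> complex_vector.subspace"

lemma cinner_add_right: "cinner x (y + z) = cinner x y + cinner x z"
  by (metis cinner_add_left cinner_commute complex_cnj_add)

lemma cinner_scaleC_right: "cinner x (c *\<^sub>C y) = cnj c * cinner x y"
  by (metis cinner_commute cinner_scaleC_left complex_cnj_mult)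

lemma cinner_0_left [simp]: "cinner 0 y = 0"
  using cinner_add_left[of 0 0 y] by simp

lemma cinner_0_right [simp]: "cinner x 0 = 0"
  using cinner_add_right[of x 0 0] by simp

lemma cinner_diff_left: "cinner (x - y) z = cinner x z - cinner y z"
  using cinner_add_left[of "x - y" y z] by simp

lemma cinner_sum_left: "cinner (\<Sum>i\<in>A. g i) y = (\<Sum>i\<in>A. cinner (g i) y)"
  by (induction A rule: infinite_finite_induct) (simp_all add: cinner_add_left)

lemma cinner_sum_right: "cinner x (\<Sum>i\<in>A. g i) = (\<Sum>i\<in>A. cinner x (g i))"
  by (induction A rule: infinite_finite_induct) (simp_all add: cinner_add_right)

lemma cinner_self: "cinner x x = complex_of_real ((norm x)\<^sup>2)"
proof -
  have "Im (cinner x x) = 0"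
    using cinner_commute[of x x] by (simp add: complex_eq_iff)
  then show ?thesis
    using Re_cinner[of x x] by (simp add: complex_eq_iff power2_norm_eq_inner)
qed

lemma cinner_self_eq_0_iff [simp]: "cinner x x = 0 \<longleftrightarrow> x = 0"
  by (simp add: cinner_self)

lemma scaleR_eq_scaleC: "r *\<^sub>R x = complex_of_real r *\<^sub>C x"
  by (simp add: scaleC_of_real)

text \<open>
  The real Cauchy--Schwarz inequality bounds the real part and, applied to \<open>\<i> *\<^sub>C x\<close>, the imaginary
  part; adding the two bounds costs the factor \<open>2\<close>, which does no harm for boundedness of linear maps.
\<close>

lemma norm_cinner_le: "norm (cinner x y) \<le> 2 * norm x * norm y"
proof -
  have "norm (\<i> *\<^sub>C x) = norm x"
    using cinner_self[of "\<i> *\<^sub>C x"] cinner_self[of x]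
    by (simp add: cinner_scaleC_left cinner_scaleC_right flip: of_real_power)
  moreover have "Im (cinner x y) = - ((\<i> *\<^sub>C x) \<bullet> y)"
    using Re_cinner[of "\<i> *\<^sub>C x" y] by (simp add: cinner_scaleC_left)
  ultimately have "\<bar>Im (cinner x y)\<bar> \<le> norm x * norm y"
    using Cauchy_Schwarz_ineq2[of "\<i> *\<^sub>C x" y] by simp
  moreover have "\<bar>Re (cinner x y)\<bar> \<le> norm x * norm y"
    using Cauchy_Schwarz_ineq2[of x y] by (simp add: Re_cinner)
  ultimately show ?thesis
    using cmod_le[of "cinner x y"] by linarith
qed

definition orthonormal :: "'a::chilbert_space set \<Rightarrow> bool" where
  "orthonormal E \<longleftrightarrow> (\<forall>x\<in>E. \<forall>y\<in>E. cinner x y = (if x = y then 1 else 0))"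

text \<open>
  The orthogonal projection onto \<open>span E\<close> when \<open>E\<close> is finite and orthonormal.
\<close>

definition proj_onto :: "'a::chilbert_space set \<Rightarrow> 'a \<Rightarrow> 'a" where
  "proj_onto E x = (\<Sum>e\<in>E. cinner x e *\<^sub>C e)"

lemma cinner_proj_onto:
  assumes "finite E" "orthonormal E" "e \<in> E"
  shows "cinner (proj_onto E x) e = cinner x e"
proof -
  have "cinner (proj_onto E x) e = (\<Sum>d\<in>E. cinner x d * cinner d e)"
    by (simp add: proj_onto_def cinner_sum_left cinner_scaleC_left)
  also have "\<dots> = (\<Sum>d\<in>E. if d = e then cinner x e else 0)"
    using assms by (intro sum.cong) (auto simp: orthonormal_def)
  finally show ?thesis
    using assms by simp
qed

lemma proj_onto_in_span: "proj_onto E x \<in> complex_vector.span E"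
  unfolding proj_onto_def
  by (intro complex_vector.span_sum complex_vector.span_scale complex_vector.span_base)

text \<open>
  The difference \<open>x - proj_onto E x\<close> lies in \<open>span E\<close> and is orthogonal to \<open>E\<close>, hence to itself.
\<close>

lemma proj_onto_eq_self:
  assumes E: "finite E" "orthonormal E" and x: "x \<in> complex_vector.span E"
  shows "proj_onto E x = x"
proof -
  let ?d = "x - proj_onto E x"
  have "E \<subseteq> {y. cinner ?d y = 0}"
    using cinner_proj_onto[OF E] by (auto simp: cinner_diff_left)
  moreover have "csubspace {y. cinner ?d y = 0}"
    by (auto simp: complex_vector.subspace_def cinner_add_right cinner_scaleC_right)
  ultimately have "complex_vector.span E \<subseteq> {y. cinner ?d y = 0}"
    by (rule complex_vector.span_minimal)
  moreover have "?d \<in> complex_vector.span E"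
    using x proj_onto_in_span by (rule complex_vector.span_diff)
  ultimately have "cinner ?d ?d = 0"
    by blast
  then show ?thesis
    by simp
qed

lemma orthonormal_independent:
  assumes "finite E" "orthonormal E"
  shows "complex_vector.independent E"
proof (rule complex_vector.independent_if_scalars_zero)
  fix u e assume sum0: "(\<Sum>x\<in>E. u x *\<^sub>C x) = 0" and e: "e \<in> E"
  have "0 = cinner (\<Sum>x\<in>E. u x *\<^sub>C x) e"
    by (simp add: sum0)
  also have "\<dots> = (\<Sum>d\<in>E. u d * cinner d e)"
    by (simp add: cinner_sum_left cinner_scaleC_left)
  also have "\<dots> = (\<Sum>d\<in>E. if d = e then u e else 0)"
    using assms e by (intro sum.cong) (auto simp: orthonormal_def)
  finally show "u e = 0"
    using assms e by simp
qed (rule assms)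

lemma Gram_Schmidt:
  assumes "finite B"
  shows "\<exists>E. finite E \<and> orthonormal E \<and> complex_vector.span E = complex_vector.span B"
  using assms
proof (induction B rule: finite_induct)
  case empty
  then show ?case
    by (intro exI[of _ "{}"]) (simp add: orthonormal_def)
next
  case (insert b B)
  then obtain E where E: "finite E" "orthonormal E"
    and span_E: "complex_vector.span E = complex_vector.span B"
    by blast
  define d where "d = b - proj_onto E b"
  have d_orth: "cinner d e = 0" if "e \<in> E" for e
    using cinner_proj_onto[OF E that] by (simp add: d_def cinner_diff_left)
  have span_insert: "complex_vector.span (insert b B) = complex_vector.span (insert d E)"
  proof -
    have "x - k *\<^sub>C b \<in> complex_vector.span E \<longleftrightarrow> x - k *\<^sub>C d \<in> complex_vector.span E" for x k
    proof -
      have "x - k *\<^sub>C d = (x - k *\<^sub>C b) + k *\<^sub>C proj_onto E b"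
        by (simp add: d_def complex_vector.scale_right_diff_distrib)
      moreover have "k *\<^sub>C proj_onto E b \<in> complex_vector.span E"
        by (intro complex_vector.span_scale proj_onto_in_span)
      ultimately show ?thesis
        by (metis complex_vector.span_add_eq2)
    qed
    then show ?thesis
      unfolding complex_vector.span_insert span_E[symmetric] by simp
  qed
  show ?case
  proof (cases "d = 0")
    case True
    then show ?thesis
      using E span_insert by auto
  next
    case False
    define e' where "e' = complex_of_real (inverse (norm d)) *\<^sub>C d"
    have "cinner e' e' = (complex_of_real (inverse (norm d)))\<^sup>2 * cinner d d"
      by (simp add: e'_def cinner_scaleC_left cinner_scaleC_right power2_eq_square)
    also have "\<dots> = 1"
      using False by (simp add: cinner_self field_simps)
    finally have "cinner e' e' = 1" .
    moreover have "cinner e' e = 0" if "e \<in> E" for e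
      using d_orth[OF that] by (simp add: e'_def cinner_scaleC_left)
    moreover then have "cinner e e' = 0" if "e \<in> E" for e
      using that cinner_commute[of e e'] by simp
    ultimately have "orthonormal (insert e' E)"
      using E(2) by (auto simp: orthonormal_def)
    moreover have "complex_vector.span (insert e' E) = complex_vector.span (insert d E)"
    proof -
      have "x - k *\<^sub>C e' = x - (k * complex_of_real (inverse (norm d))) *\<^sub>C d"
        and "x - k *\<^sub>C d = x - (k * complex_of_real (norm d)) *\<^sub>C e'" for x k
        using False by (simp_all add: e'_def scaleC_scaleC)
      then show ?thesis
        unfolding complex_vector.span_insert by (metis (no_types, lifting))
    qed
    ultimately show ?thesis
      using E(1) span_insert by (intro exI[of _ "insert e' E"]) simp
  qed
qed


lemma norm_scaleC: "norm (c *\<^sub>C x) = cmod c * norm x"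
proof -
  have "complex_of_real ((norm (c *\<^sub>C x))\<^sup>2) = (c * cnj c) * cinner x x"
    unfolding cinner_self[symmetric] by (simp add: cinner_scaleC_left cinner_scaleC_right)
  also have "\<dots> = complex_of_real ((cmod c * norm x)\<^sup>2)"
    by (simp only: complex_norm_square[symmetric] cinner_self power_mult_distrib of_real_mult)
  finally have "(norm (c *\<^sub>C x))\<^sup>2 = (cmod c * norm x)\<^sup>2"
    by (simp only: of_real_eq_iff)
  then show ?thesis
    by (simp add: power2_eq_iff_nonneg)
qed

section \<open>The joint spectrum of two projections\<close>

lemma projectionsD:
  assumes "P \<in> projections"
  shows "P (x + y) = P x + P y" "P (c *\<^sub>C x) = c *\<^sub>C P x" "P (P x) = P x"
    "cinner (P x) y = cinner x (P y)"
  using assms by (auto simp: projections_def bounded_operator_def is_adjoint_def linear_simps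
      dest: fun_cong[of "P \<circ> P"])

lemma projection_range_iff:
  assumes "P \<in> projections"
  shows "x \<in> range P \<longleftrightarrow> P x = x"
  using projectionsD(3)[OF assms] by (metis rangeE rangeI)

lemma projection_0:
  assumes "P \<in> projections"
  shows "P 0 = 0"
  using projectionsD(1)[OF assms, of 0 0] by simp

lemma projection_range_subspace:
  assumes "P \<in> projections"
  shows "csubspace (range P)"
  unfolding complex_vector.subspace_def projection_range_iff[OF assms]
  by (simp add: projectionsD[OF assms] projection_0[OF assms])

lemma projection_eq_0_iff:
  assumes P: "P \<in> projections"
  shows "P x = 0 \<longleftrightarrow> (\<forall>y\<in>range P. cinner x y = 0)"
proof
  assume "\<forall>y\<in>range P. cinner x y = 0"
  then have "cinner x (P (P x)) = 0"
    by blast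
  then have "cinner (P x) (P x) = 0"
    by (simp add: projectionsD(4)[OF P, symmetric])
  then show "P x = 0"
    by simp
qed (auto simp: projectionsD(4)[OF P, symmetric])

text \<open>
  If the ranges agree, then \<open>Q P = P\<close> and \<open>P Q = Q\<close>; taking adjoints in the first equation yields
  \<open>P Q = P\<close>.
\<close>

lemma projection_determined_by_range:
  assumes P: "P \<in> projections" and Q: "Q \<in> projections" and PQ: "range P = range Q"
  shows "P = Q"
proof
  fix x
  have QP: "Q (P y) = P y" and PQ': "P (Q y) = Q y" for y
    using projection_range_iff[OF P] projection_range_iff[OF Q] PQ by (metis rangeI)+
  have "cinner (P x) y = cinner (Q x) y" for y
  proof -
    have "cinner (P x) y = cinner (Q (P x)) y"
      by (simp add: QP)
    also have "\<dots> = cinner x (P (Q y))"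
      by (simp add: projectionsD(4)[OF P] projectionsD(4)[OF Q])
    finally show ?thesis
      by (simp add: PQ' projectionsD(4)[OF Q])
  qed
  then have "cinner (P x - Q x) (P x - Q x) = 0"
    by (simp add: cinner_diff_left)
  then show "P x = Q x"
    by simp
qed

lemma joint_spectrum_pair_iff:
  "[a, b] \<in> joint_spectrum [P, Q] \<longleftrightarrow> \<not> invertible_operator (\<lambda>x. a *\<^sub>C P x + b *\<^sub>C Q x)"
  by (simp add: joint_spectrum_def numeral_2_eq_2)

locale orthonormal_basis =
  fixes E :: "'a::chilbert_space set"
  assumes finite_E: "finite E" and orthonormal_E: "orthonormal E"
    and span_E: "complex_vector.span E = UNIV"
begin

sublocale fd: fin_dim_space "scaleC :: complex \<Rightarrow> 'a \<Rightarrow> 'a" E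
  by unfold_locales (use finite_E orthonormal_E span_E orthonormal_independent in auto)

lemma bounded_operatorI:
  assumes add: "\<And>x y. A (x + y) = A x + A y" and scale: "\<And>c x. A (c *\<^sub>C x) = c *\<^sub>C A x"
  shows "bounded_operator (A :: 'a \<Rightarrow> 'a)"
proof -
  have A_0: "A 0 = 0"
    using add[of 0 0] by simp
  have A_sum: "A (\<Sum>e\<in>D. g e) = (\<Sum>e\<in>D. A (g e))" for g and D :: "'a set"
    by (induction D rule: infinite_finite_induct) (simp_all add: add A_0)
  have "norm (A x) \<le> norm x * (\<Sum>e\<in>E. 2 * norm e * norm (A e))" for x
  proof -
    have "A x = A (proj_onto E x)"
      using proj_onto_eq_self[OF finite_E orthonormal_E] span_E by simp
    also have "\<dots> = (\<Sum>e\<in>E. cinner x e *\<^sub>C A e)"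
      by (simp add: proj_onto_def A_sum scale)
    finally have "norm (A x) \<le> (\<Sum>e\<in>E. norm (cinner x e *\<^sub>C A e))"
      by (simp add: norm_sum)
    also have "\<dots> \<le> (\<Sum>e\<in>E. (2 * norm x * norm e) * norm (A e))"
      by (intro sum_mono) (simp add: norm_scaleC mult_right_mono norm_cinner_le)
    also have "\<dots> = norm x * (\<Sum>e\<in>E. 2 * norm e * norm (A e))"
      by (simp add: sum_distrib_left mult_ac)
    finally show ?thesis .
  qed
  then have "bounded_linear A"
    using add scale by (intro bounded_linear_intro) (auto simp: scaleR_eq_scaleC)
  then show ?thesis
    using scale by (simp add: bounded_operator_def)
qed

lemma invertible_operator_iff_inj:
  assumes add: "\<And>x y. A (x + y) = A x + A y" and scale: "\<And>c x. A (c *\<^sub>C x) = c *\<^sub>C A x"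
  shows "invertible_operator (A :: 'a \<Rightarrow> 'a) \<longleftrightarrow> inj A"
proof
  assume "invertible_operator A"
  then show "inj A"
    unfolding invertible_operator_def by (metis inj_on_id inj_on_imageI2)
next
  assume inj: "inj A"
  have lin: "Vector_Spaces.linear scaleC scaleC A"
    by unfold_locales (simp_all add: add scale)
  have surj: "surj A"
    using fd.linear_inj_imp_surj[OF lin inj] .
  have "Vector_Spaces.linear scaleC scaleC (inv A)"
    using fd.inj_linear_imp_inv_linear[OF lin inj] .
  then have "bounded_operator (inv A)"
    unfolding Vector_Spaces.linear_iff by (intro bounded_operatorI) blast+
  moreover have "A \<circ> inv A = id" "inv A \<circ> A = id"
    using surj inj by (simp_all add: surj_iff inj_iff)
  ultimately show "invertible_operator A"
    using bounded_operatorI[OF add scale] by (auto simp: invertible_operator_def)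
qed

lemma projection_onto_subspace:
  assumes "csubspace M"
  obtains P where "P \<in> projections" "range P = (M :: 'a set)"
proof -
  obtain B where "B \<subseteq> M" "complex_vector.independent B" "M \<subseteq> complex_vector.span B"
    using complex_vector.maximal_independent_subset[of M] by blast
  then have "finite B" "complex_vector.span B = M"
    using fd.finiteI_independent complex_vector.span_minimal[OF _ assms, of B] by auto
  then obtain D where D: "finite D" "orthonormal D" and span_D: "complex_vector.span D = M"
    using Gram_Schmidt by blast
  have "proj_onto D \<in> projections"
    unfolding projections_def mem_Collect_eq
  proof (intro conjI)
    show "bounded_operator (proj_onto D)"
      by (rule bounded_operatorI)
        (simp_all add: proj_onto_def cinner_add_left cinner_scaleC_left scaleC_add_left
          sum.distrib complex_vector.scale_sum_right)
    show "is_adjoint (proj_onto D) (proj_onto D)"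
      unfolding is_adjoint_def proj_onto_def cinner_sum_left cinner_sum_right
        cinner_scaleC_left cinner_scaleC_right
      by (simp add: cinner_commute[symmetric] mult.commute)
    show "proj_onto D \<circ> proj_onto D = proj_onto D"
      using proj_onto_eq_self[OF D proj_onto_in_span] by auto
  qed
  moreover have "range (proj_onto D) = M"
  proof (intro equalityI subsetI)
    show "x \<in> M" if "x \<in> range (proj_onto D)" for x
      using that proj_onto_in_span[of D] span_D by auto
    show "x \<in> range (proj_onto D)" if "x \<in> M" for x
      using proj_onto_eq_self[OF D, of x] that span_D rangeI[of "proj_onto D" x] by simp
  qed
  ultimately show ?thesis
    by (rule that)
qed

text \<open>
  In finite dimension only the kernel matters. If \<open>a P x + b Q x = 0\<close>, then \<open>y = a P x = - b Q x\<close> lies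
  in both ranges. When \<open>a\<close> and \<open>b\<close> are nonzero, \<open>cinner (P x) y = cinner x y = cinner (Q x) y\<close>, which
  gives \<open>(a + b) * cinner y y = 0\<close>. So \<open>y = 0\<close>, either because \<open>a + b \<noteq> 0\<close> or because the ranges meet in
  \<open>0\<close>, and \<open>x\<close> is orthogonal to both ranges.

  Conversely, the range of \<open>a P + b Q\<close> lies in the sum of the ranges, and for \<open>a + b = 0\<close> the
  operator kills their intersection. Replacing the range by \<open>{0}\<close> when the coefficient is \<open>0\<close> makes the
  formula uniform.
\<close>

lemma invertible_combination_iff:
  fixes a b :: complex
  assumes P: "P \<in> projections" and Q: "Q \<in> projections"
  defines "M \<equiv> if a = 0 then {0} else range P" and "N \<equiv> if b = 0 then {0} else range Q"
  shows "invertible_operator (\<lambda>x::'a. a *\<^sub>C P x + b *\<^sub>C Q x) \<longleftrightarrow>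
    complex_vector.span (M \<union> N) = UNIV \<and> (a + b \<noteq> 0 \<or> M \<inter> N = {0})"
proof -
  let ?A = "\<lambda>x. a *\<^sub>C P x + b *\<^sub>C Q x"
  have add: "?A (x + y) = ?A x + ?A y" and scale: "?A (c *\<^sub>C x) = c *\<^sub>C ?A x" for x y c
    by (simp_all add: projectionsD[OF P] projectionsD[OF Q] scaleC_add_right scaleC_scaleC mult.commute)
  have lin: "Vector_Spaces.linear scaleC scaleC ?A"
    by unfold_locales (simp_all only: add scale)
  have inv: "invertible_operator ?A \<longleftrightarrow> inj ?A"
    using add scale by (rule invertible_operator_iff_inj)
  have inj_iff: "inj ?A \<longleftrightarrow> (\<forall>x. ?A x = 0 \<longrightarrow> x = 0)"
  proof -
    have "?A x = ?A y \<longleftrightarrow> ?A (x - y) = 0" for x y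
      using add[of "x - y" y] by simp
    moreover have "?A 0 = 0"
      by (simp add: projection_0 P Q)
    ultimately show ?thesis
      unfolding inj_def by (metis diff_0_right eq_iff_diff_eq_0)
  qed
  have sub: "csubspace M" "csubspace N"
    by (simp_all add: M_def N_def projection_range_subspace P Q)
  have aP: "a *\<^sub>C P x \<in> M" and bQ: "b *\<^sub>C Q x \<in> N" for x
    using projection_range_subspace[OF P] projection_range_subspace[OF Q]
    by (simp_all add: M_def N_def complex_vector.subspace_scale)
  show ?thesis
  proof
    assume "invertible_operator ?A"
    then have inj: "inj ?A"
      using inv by simp
    have "y \<in> complex_vector.span (M \<union> N)" for y
    proof -
      obtain x where "y = ?A x"
        using fd.linear_inj_imp_surj[OF lin inj] by blast
      then show ?thesis
        using aP[of x] bQ[of x]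
        by (simp add: complex_vector.span_add complex_vector.span_base)
    qed
    moreover have "x = 0" if "a + b = 0" "x \<in> M" "x \<in> N" for x
    proof (cases "a = 0 \<or> b = 0")
      case True
      then show ?thesis
        using that by (auto simp: M_def N_def)
    next
      case False
      then have "P x = x" "Q x = x"
        using that projection_range_iff[OF P] projection_range_iff[OF Q] by (simp_all add: M_def N_def)
      then have "?A x = (a + b) *\<^sub>C x"
        by (simp add: scaleC_add_left)
      then have "?A x = 0"
        using that(1) by simp
      then show ?thesis
        using inj inj_iff by blast
    qed
    moreover have "0 \<in> M" "0 \<in> N"
      using sub by (simp_all add: complex_vector.subspace_0)
    ultimately show "complex_vector.span (M \<union> N) = UNIV \<and> (a + b \<noteq> 0 \<or> M \<inter> N = {0})"
      by blast
  next
    assume R: "complex_vector.span (M \<union> N) = UNIV \<and> (a + b \<noteq> 0 \<or> M \<inter> N = {0})"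
    have "x = 0" if "?A x = 0" for x
    proof -
      define y where "y = a *\<^sub>C P x"
      have y: "y = - (b *\<^sub>C Q x)"
        using that by (simp add: y_def eq_neg_iff_add_eq_0)
      have "y \<in> M" "y \<in> N"
        using aP[of x] bQ[of x] y sub(2) by (simp_all add: y_def complex_vector.subspace_neg)
      have "y = 0"
      proof (cases "M \<inter> N = {0}")
        case True
        then show ?thesis
          using \<open>y \<in> M\<close> \<open>y \<in> N\<close> by blast
      next
        case False
        then have ab: "a \<noteq> 0" "b \<noteq> 0" "a + b \<noteq> 0"
          using R complex_vector.subspace_0[OF sub(1)] complex_vector.subspace_0[OF sub(2)]
          by (auto simp: M_def N_def split: if_splits)
        then have "P y = y" "Q y = y"
          using \<open>y \<in> M\<close> \<open>y \<in> N\<close> projection_range_iff[OF P] projection_range_iff[OF Q]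
          by (simp_all add: M_def N_def)
        then have "cinner (P x) y = cinner (Q x) y"
          by (simp add: projectionsD(4)[OF P] projectionsD(4)[OF Q])
        moreover have "cinner y y = a * cinner (P x) y"
          by (metis y_def cinner_scaleC_left)
        moreover have "cinner y y = - b * cinner (Q x) y"
          by (metis y complex_vector.scale_minus_left cinner_scaleC_left)
        ultimately have "a * cinner (P x) y = - b * cinner (P x) y"
          by metis
        then have "(a + b) * cinner (P x) y = 0"
          by (simp add: distrib_right)
        then have "cinner y y = 0"
          using ab \<open>cinner y y = a * cinner (P x) y\<close> by simp
        then show ?thesis
          by simp
      qed
      then have "a *\<^sub>C P x = 0" "b *\<^sub>C Q x = 0"
        using y by (simp_all only: y_def[symmetric] neg_equal_0_iff_equal minus_equation_iff[of 0] minus_zero)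
      then have "a = 0 \<or> P x = 0" "b = 0 \<or> Q x = 0"
        by simp_all
      then have "M \<union> N \<subseteq> {z. cinner x z = 0}"
        using projection_eq_0_iff[OF P, of x] projection_eq_0_iff[OF Q, of x]
        by (auto simp: M_def N_def)
      moreover have "csubspace {z. cinner x z = 0}"
        by (auto simp: complex_vector.subspace_def cinner_add_right cinner_scaleC_right)
      ultimately have "complex_vector.span (M \<union> N) \<subseteq> {z. cinner x z = 0}"
        by (rule complex_vector.span_minimal)
      then have "cinner x x = 0"
        using R by blast
      then show ?thesis
        by simp
    qed
    then show "invertible_operator ?A"
      using inv inj_iff by blast
  qed
qed

text \<open>
  Two points of the joint spectrum suffice to detect spanning and complementary pairs of ranges.
\<close>

lemma span_Un_ranges_iff:
  assumes "P \<in> projections" "Q \<in> projections"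
  shows "complex_vector.span (range P \<union> range Q) = (UNIV :: 'a set)
    \<longleftrightarrow> [1, 1] \<notin> joint_spectrum [P, Q]"
  unfolding joint_spectrum_pair_iff using invertible_combination_iff[OF assms, of 1 1] by simp

lemma complementary_ranges_iff:
  assumes "P \<in> projections" "Q \<in> projections"
  shows "fd.complementary (range P) (range Q :: 'a set) \<longleftrightarrow> [1, -1] \<notin> joint_spectrum [P, Q]"
  unfolding joint_spectrum_pair_iff fd.complementary_def
  using invertible_combination_iff[OF assms, of 1 "-1"] projection_range_subspace assms by auto

end

section \<open>Maps that shrink the joint spectrum\<close>

context orthonormal_basis
begin

lemma indexed_basis_iff: "fd.indexed_basis {1..n} \<beta> \<longleftrightarrow> is_basis n \<beta>"
  by (simp add: fd.indexed_basis_def is_basis_def)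

lemma orthonormal_basis_enumeration:
  assumes "card E = n"
  obtains \<alpha> where "is_orthonormal_basis n (\<alpha> :: nat \<Rightarrow> 'a)"
proof -
  obtain \<alpha> where \<alpha>: "bij_betw \<alpha> {1..n} E"
    using ex_bij_betw_nat_finite_1[OF finite_E] assms by blast
  then have "is_basis n \<alpha>"
    using span_E orthonormal_independent[OF finite_E orthonormal_E]
    by (auto simp: is_basis_def bij_betw_def)
  moreover have "cinner (\<alpha> i) (\<alpha> j) = (if i = j then 1 else 0)" if "i \<in> {1..n}" "j \<in> {1..n}" for i j
    using \<alpha> orthonormal_E that unfolding orthonormal_def bij_betw_def
    by (metis imageI inj_on_eq_iff)
  ultimately have "is_orthonormal_basis n \<alpha>"
    unfolding is_orthonormal_basis_def by blast
  then show ?thesis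
    by (rule that)
qed

definition projection_on :: "'a set \<Rightarrow> 'a \<Rightarrow> 'a" where
  "projection_on M = (SOME P. P \<in> projections \<and> range P = M)"

lemma projection_on:
  assumes "csubspace M"
  shows "projection_on M \<in> projections" "range (projection_on M) = M"
proof -
  have "\<exists>P. P \<in> projections \<and> range P = M"
    using projection_onto_subspace[OF assms] by metis
  from someI_ex[OF this] show "projection_on M \<in> projections" "range (projection_on M) = M"
    unfolding projection_on_def by blast+
qed

lemma projection_on_range:
  assumes "P \<in> projections"
  shows "projection_on (range P) = P"
  using projection_on[OF projection_range_subspace[OF assms]] assms
  by (intro projection_determined_by_range)

text \<open>
  An inclusion of joint spectra means that noninvertibility is reflected, so invertible combinations
  stay invertible; at the points \<open>[1, 1]\<close> and \<open>[1, -1]\<close> this is preservation of spanning and of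
  complementary pairs.
\<close>

lemma complement_preserving_of_shrinking:
  assumes surj: "\<phi> ` projections = projections"
    and shrinks: "\<And>P Q. P \<in> projections \<Longrightarrow> Q \<in> projections \<Longrightarrow>
      joint_spectrum [\<phi> P, \<phi> Q] \<subseteq> joint_spectrum [P, Q]"
  shows "complement_preserving scaleC E (\<lambda>M. range (\<phi> (projection_on M)))"
proof unfold_locales
  have \<phi>: "\<phi> (projection_on M) \<in> projections" if "csubspace M" for M
    using surj projection_on[OF that] by blast
  show "(\<lambda>M. range (\<phi> (projection_on M))) ` Collect csubspace = Collect csubspace"
  proof (intro equalityI subsetI)
    fix N :: "'a set" assume "N \<in> Collect csubspace"
    then have N: "csubspace N"
      by simp
    obtain P where P: "P \<in> projections" "projection_on N = \<phi> P"
      using projection_on(1)[OF N] surj by blast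
    then have "N = range (\<phi> (projection_on (range P)))"
      using projection_on(2)[OF N] by (simp add: projection_on_range)
    then show "N \<in> (\<lambda>M. range (\<phi> (projection_on M))) ` Collect csubspace"
      using projection_range_subspace[OF P(1)] by blast
  qed (use \<phi> projection_range_subspace in auto)
  show "complex_vector.span (range (\<phi> (projection_on M)) \<union> range (\<phi> (projection_on N))) = UNIV"
    if MN: "csubspace M" "csubspace N" "complex_vector.span (M \<union> N) = UNIV" for M N
    using MN shrinks[of "projection_on M" "projection_on N"] \<phi>
      span_Un_ranges_iff[of "projection_on M" "projection_on N"]
      span_Un_ranges_iff[of "\<phi> (projection_on M)" "\<phi> (projection_on N)"]
    by (auto simp: projection_on)
  show "fd.complementary (range (\<phi> (projection_on M))) (range (\<phi> (projection_on N)))"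
    if c: "fd.complementary M N" for M N
    using c fd.complementaryD[OF c] shrinks[of "projection_on M" "projection_on N"] \<phi>
      complementary_ranges_iff[of "projection_on M" "projection_on N"]
      complementary_ranges_iff[of "\<phi> (projection_on M)" "\<phi> (projection_on N)"]
    by (auto simp: projection_on)
qed

text \<open>
  By \<open>invertible_combination_iff\<close> the joint spectrum depends only on which ranges span and
  which meet in \<open>0\<close>, and a semilinear bijection respects both.
\<close>

lemma joint_spectrum_eq_of_semilinear_image:
  assumes P: "P \<in> projections" "P' \<in> projections" and Q: "Q \<in> projections" "Q' \<in> projections"
    and h: "semilinear_bijection scaleC E f h" and "range P' = h ` range P" "range Q' = h ` range Q"
  shows "joint_spectrum [P', Q'] = joint_spectrum [P, Q :: 'a \<Rightarrow> 'a]"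
proof -
  interpret h: semilinear_bijection scaleC E f h
    by (rule h)
  have "invertible_operator (\<lambda>x. a *\<^sub>C P' x + b *\<^sub>C Q' x)
      \<longleftrightarrow> invertible_operator (\<lambda>x. a *\<^sub>C P x + b *\<^sub>C Q x)" for a b
  proof -
    define M where "M = (if a = 0 then {0} else range P)"
    define N where "N = (if b = 0 then {0} else range Q)"
    have "(if a = 0 then {0} else range P') = h ` M" "(if b = 0 then {0} else range Q') = h ` N"
      using assms(6,7) by (auto simp: M_def N_def h.h_0)
    then show ?thesis
      unfolding invertible_combination_iff[OF P(1) Q(1)] invertible_combination_iff[OF P(2) Q(2)]
      by (simp add: M_def[symmetric] N_def[symmetric] h.span_Un_image_iff h.Int_image_iff)
  qed
  then have "[a, b] \<in> joint_spectrum [P', Q'] \<longleftrightarrow> [a, b] \<in> joint_spectrum [P, Q]" for a b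
    unfolding joint_spectrum_pair_iff by simp
  moreover have "\<exists>a b. cs = [a, b]" if "cs \<in> joint_spectrum [A, B]" for cs and A B :: "'a \<Rightarrow> 'a"
    using that by (auto simp: joint_spectrum_def length_Suc_conv)
  ultimately show ?thesis
    by (metis subsetI subset_antisym)
qed

end

lemma orthonormal_basis_exists:
  assumes "complex_vector.dim (UNIV :: 'a::chilbert_space set) = n" "0 < n"
  obtains E where "orthonormal_basis (E :: 'a set)" "card E = n"
proof -
  obtain B :: "'a set" where B: "complex_vector.independent B" "UNIV \<subseteq> complex_vector.span B" "card B = n"
    using complex_vector.basis_exists[of UNIV] assms(1) by metis
  then have "finite B"
    using assms(2) card.infinite by fastforce
  then obtain E where E: "finite E" "orthonormal E" "complex_vector.span E = complex_vector.span B"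
    using Gram_Schmidt by blast
  then have basis: "orthonormal_basis E"
    using B by unfold_locales auto
  moreover have "card E = n"
    using complex_vector.basis_card_eq_dim[of E UNIV] E B orthonormal_independent assms(1) by auto
  ultimately show ?thesis
    by (rule that)
qed

theorem theorem1p1:
  fixes n :: nat
    and \<phi> :: "('a::chilbert_space \<Rightarrow> 'a) \<Rightarrow> ('a \<Rightarrow> 'a)"
  assumes dim: "complex_vector.dim (UNIV :: 'a set) = n"
    and n: "3 \<le> n"
    and surj: "\<phi> ` projections = projections"
  defines "shrinks \<equiv> \<forall>P\<in>projections. \<forall>Q\<in>projections.
             joint_spectrum [\<phi> P, \<phi> Q] \<subseteq> joint_spectrum [P, Q]"
    and "preserves \<equiv> \<forall>P\<in>projections. \<forall>Q\<in>projections.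
             joint_spectrum [\<phi> P, \<phi> Q] = joint_spectrum [P, Q]"
    and "induced \<equiv> \<exists>\<alpha> \<beta> f h.
             is_orthonormal_basis n \<alpha> \<and> is_basis n \<beta> \<and> complex_ring_automorphism f \<and>
             is_hat n \<alpha> \<beta> f h \<and>
             (\<forall>P\<in>projections. range (\<phi> P) = {h (P \<xi>) | \<xi>. True})"
  shows "(shrinks \<longleftrightarrow> preserves) \<and> (preserves \<longleftrightarrow> induced)"
proof -
  obtain E :: "'a set" where E: "orthonormal_basis E" and card_E: "card E = n"
    using orthonormal_basis_exists[OF dim] n by auto
  interpret orthonormal_basis E
    by (rule E)
  have "induced" if shrinks
  proof -
    obtain \<alpha> :: "nat \<Rightarrow> 'a" where \<alpha>: "is_orthonormal_basis n \<alpha>"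
      using orthonormal_basis_enumeration[OF card_E] by blast
    then have \<alpha>_basis: "fd.indexed_basis {1..n} \<alpha>"
      unfolding indexed_basis_iff is_orthonormal_basis_def by blast
    have card: "3 \<le> card {1..n}"
      using n by simp
    have \<phi>: "complement_preserving scaleC E (\<lambda>M. range (\<phi> (projection_on M)))"
      using surj that by (intro complement_preserving_of_shrinking) (auto simp: shrinks_def)
    obtain \<beta> f h where \<beta>: "fd.indexed_basis {1..n} \<beta>" and f: "field_automorphism f"
      and h: "\<And>c. h (fd.lincomb {1..n} \<alpha> c) = fd.lincomb {1..n} \<beta> (\<lambda>i. f (c i))"
      and image: "\<And>M. csubspace M \<Longrightarrow> range (\<phi> (projection_on M)) = h ` M"
      by (rule complement_preserving.semilinear_representation[OF \<phi> \<alpha>_basis card]) blast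
    have "range (\<phi> P) = {h (P \<xi>) | \<xi>. True}" if "P \<in> projections" for P
      using image[OF projection_range_subspace[OF that]] by (auto simp: projection_on_range that)
    moreover have "is_hat n \<alpha> \<beta> f h"
      using h unfolding is_hat_def fd.lincomb_def by blast
    moreover have "is_basis n \<beta>"
      using \<beta> unfolding indexed_basis_iff .
    moreover have "complex_ring_automorphism f"
      using f by (simp add: complex_ring_automorphism_def field_automorphism_def)
    ultimately show induced
      unfolding induced_def using \<alpha> by blast
  qed
  moreover have preserves if ind: induced
  proof -
    obtain \<alpha> \<beta> f h where \<alpha>: "is_orthonormal_basis n \<alpha>" and \<beta>: "is_basis n \<beta>"
      and f: "complex_ring_automorphism f" and h: "is_hat n \<alpha> \<beta> f h"
      and range: "\<And>P. P \<in> projections \<Longrightarrow> range (\<phi> P) = {h (P \<xi>) | \<xi>. True}"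
      using ind unfolding induced_def by blast
    have semilinear: "semilinear_bijection scaleC E f h"
    proof (rule fd.semilinear_bijection_of_bases)
      show "fd.indexed_basis {1..n} \<alpha>" "fd.indexed_basis {1..n} \<beta>"
        using \<alpha> \<beta> unfolding indexed_basis_iff is_orthonormal_basis_def by blast+
      show "field_automorphism f"
        using f by (simp add: complex_ring_automorphism_def field_automorphism_def)
      show "h (fd.lincomb {1..n} \<alpha> c) = fd.lincomb {1..n} \<beta> (\<lambda>i. f (c i))" for c
        using h unfolding is_hat_def fd.lincomb_def by blast
    qed
    have "range (\<phi> P) = h ` range P" if "P \<in> projections" for P
      using range[OF that] by auto
    then show preserves
      unfolding preserves_def using surj
      by (intro ballI joint_spectrum_eq_of_semilinear_image[OF _ _ _ _ semilinear]) auto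
  qed
  moreover have shrinks if preserves
    using that by (simp add: shrinks_def preserves_def)
  ultimately show ?thesis
    by blast
qed

end
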